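(* Let $G$ be a finite group and $p$ a prime, and let $\mathbf 1_G$ denote the trivial $\mathbb{Z}_p[G]$-lattice $\mathbb{Z}_p$. Then $v_p(C_{\theta_G}(\mathbf 1_G))\neq0$ if and only if $G$ contains a non-cyclic $p$-hypo-elementary subgroup. Moreover, if $G$ contains a non-cyclic $p$-hypo-elementary subgroup, then $v_p(C_{\theta_G}(\mathbf 1_G))\le -p/|G|$.
   Context: A finite group is $p$-hypo-elementary if it has a normal Sylow $p$-subgroup with cyclic quotient. Burnside ring: $b(G)$ is the free abelian group on the symbols $[H]$ ($H$ up to conjugacy, $[H]$ standing for $G/H$), and $B(G)=b(G)\otimes\mathbb{Q}$. Artin relation: there are unique $\alpha_H\in\mathbb{Q}$, for $H$ running over representatives of conjugacy classes of cyclic subgroups, with $[\mathbf 1]=\sum_H\alpha_H[\mathbb{Q}[G/H]]$ in $A(\mathbb{Q}[G])$ (rational representation ring tensored with $\mathbb{Q}$). The Artin relation is $\theta_G=[G]-\sum_H\alpha_H[H]\in B(G)$; it lies in the kernel of $[H]\mapsto[\mathbb{Q}[G/H]]$. Regulator constants: for an integral relation $\theta=\sum_i[H_i]-\sum_j[H'_j]$ and a $\mathbb{Z}_p[G]$-lattice $M$ with non-degenerate $G$-invariant symmetric $\mathbb{Q}_p$-valued form $\langle\ ,\ \rangle$, set $$C_\theta(M)=\frac{\prod_i\det\big(\tfrac{1}{|H_i|}\langle\ ,\ \rangle|_{M^{H_i}}\big)}{\prod_j\det\big(\tfrac{1}{|H'_j|}\langle\ ,\ \rangle|_{M^{H'_j}}\big)}\in\mathbb{Q}_p^\times/(\mathbb{Z}_p^\times)^2,$$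 using Gram determinants with respect to $\mathbb{Z}_p$-bases; the value is independent of the form. For a rational relation $\theta$, $v_p(C_\theta(M))=\frac1n v_p(C_{n\theta}(M))$ with $n\theta$ integral. For $\mathbf 1_G$ with form $\langle x,y\rangle=xy$ this gives $v_p(C_\theta(\mathbf 1_G))=\sum_j v_p(|H'_j|)-\sum_i v_p(|H_i|)$, extended linearly. *)

theory Defs
  imports Complex_Main "HOL-Algebra.Elementary_Groups" "HOL-Computational_Algebra.Primes"
begin

definition conj_class :: "('a, 'b) monoid_scheme \<Rightarrow> 'a set \<Rightarrow> 'a set set" where
  "conj_class G H = {(\<lambda>h. g \<otimes>\<^bsub>G\<^esub> h \<otimes>\<^bsub>G\<^esub> inv\<^bsub>G\<^esub> g) ` H | g. g \<in> carrier G}"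

definition subgroup_classes :: "('a, 'b) monoid_scheme \<Rightarrow> 'a set set set" where
  "subgroup_classes G = {conj_class G H | H. subgroup H G}"

definition cyclic_subgroup_classes :: "('a, 'b) monoid_scheme \<Rightarrow> 'a set set set" where
  "cyclic_subgroup_classes G =
     {conj_class G H | H. subgroup H G \<and> cyclic_group (G\<lparr>carrier := H\<rparr>)}"

definition rep :: "'a set set \<Rightarrow> 'a set" where
  "rep C = (SOME H. H \<in> C)"

(* character of the permutation representation Q[G/H] at g:
   number of left cosets xH fixed by g *)
definition perm_char :: "('a, 'b) monoid_scheme \<Rightarrow> 'a set \<Rightarrow> 'a \<Rightarrow> nat" where
  "perm_char G H g = card {C. (\<exists>x \<in> carrier G. C = x <#\<^bsub>G\<^esub> H) \<and> g <#\<^bsub>G\<^esub> C = C}"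

(* Artin coefficients: the unique alpha, supported on conjugacy classes of cyclic subgroups,
   with [1] = sum alpha_H [Q[G/H]] in A(Q[G]); equality in the rational representation
   ring (tensored with Q) is tested on characters. *)
definition artin_coeff :: "('a, 'b) monoid_scheme \<Rightarrow> 'a set set \<Rightarrow> rat" where
  "artin_coeff G = (THE \<alpha>. (\<forall>C. C \<notin> cyclic_subgroup_classes G \<longrightarrow> \<alpha> C = 0) \<and>
      (\<forall>g \<in> carrier G. (1::rat) =
          (\<Sum>C \<in> cyclic_subgroup_classes G. \<alpha> C * of_nat (perm_char G (rep C) g))))"

(* Elements of B(G) = b(G) \<otimes> Q, as functions from conjugacy classes of subgroups to Q.
   The Artin relation theta_G = [G] - sum_H alpha_H [H]: *)
definition artin_relation :: "('a, 'b) monoid_scheme \<Rightarrow> 'a set set \<Rightarrow> rat" where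
  "artin_relation G C =
     (if C = conj_class G (carrier G) then 1 else 0) - artin_coeff G C"

(* v_p(C_theta(1_G)) = sum_j v_p|H'_j| - sum_i v_p|H_i|, extended linearly *)
definition vp_regconst_triv :: "('a, 'b) monoid_scheme \<Rightarrow> nat \<Rightarrow> ('a set set \<Rightarrow> rat) \<Rightarrow> rat" where
  "vp_regconst_triv G p \<theta> =
     - (\<Sum>C \<in> subgroup_classes G. \<theta> C * of_nat (multiplicity p (card (rep C))))"

definition p_hypo_elementary :: "('a, 'b) monoid_scheme \<Rightarrow> nat \<Rightarrow> 'a set \<Rightarrow> bool" where
  "p_hypo_elementary G p H \<longleftrightarrow> subgroup H G \<and>
     (\<exists>P. subgroup P (G\<lparr>carrier := H\<rparr>) \<and> card P = p ^ multiplicity p (card H) \<and>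
          P \<lhd> (G\<lparr>carrier := H\<rparr>) \<and> cyclic_group ((G\<lparr>carrier := H\<rparr>) Mod P))"

end

theory Submission
  imports Defs "HOL-Algebra.Multiplicative_Group" "HOL-Algebra.Sylow" "HOL-Algebra.Left_Coset"
    "HOL-Number_Theory.Totient"
begin

text \<open>
  Write |G| = p^a m with p not dividing m, and give g the weight v(g) + [v(g) > 0] / (p - 1), where
  v(g) is the p-adic valuation of the order of g. Over a cyclic group H the weights add up to
  |H| v_p|H|, so multiplying the defining equation of the Artin coefficients by the weight and
  summing over G gives |G| v_p(C) = (sum of the weights over G) - |G| a. With
  N_j = #{g. v(g) \<le> j} this says that -|G| v_p(C) is the sum of N_j - m p^j over j < a, plus
  (N_0 - m) / (p - 1). By (a case of) Frobenius' theorem m p^j divides N_j, hence every summand is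
  nonnegative, and congruences modulo p and p - 1 show that the sum is at least p unless it vanishes.

  If all p-hypo-elementary subgroups are cyclic, then the Sylow p-subgroup is cyclic and its elements
  are pairwise nonconjugate, which forces N_j = m p^j. Conversely, N_j = m p^j for all j < a forces a
  cyclic Sylow subgroup no two generators of which are conjugate; by Burnside's fusion argument the
  normal Sylow subgroup of any p-hypo-elementary K is then cyclic and central in K, so K is cyclic.
\<close>

text \<open>The Artin coefficients are never computed. They are only paired with one class function,
  the weight, whose sum against the permutation character of G/H is |G| v_p|H| for every cyclic H;
  the valuation depends on the coefficients through nothing else. Since \<open>artin_coeff\<close>
  is a definite description, existence and uniqueness must still be shown; they hold because the
  values of these characters on cyclic classes form a triangular matrix when the classes are ranked
  by subgroup order. The correction 1 / (p - 1) comes from the cyclic group of order p^a. There p^i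
  - p^(i-1) elements have valuation i \<ge> 1, so the valuations add up to a p^a - (p^a - 1) / (p -
  1), and the missing amount is shared equally by the p^a - 1 elements of order divisible by p. The
  counts N_j are controlled by two partitions: by the conjugacy class of the p-part, which yields
  the factor m, and by the generated cyclic subgroup, which yields p^j (p - 1) for the complement.
  Only together do they give the divisibility by m p^j and the lower bound p.\<close>

section \<open>Counting along fibres; triangular linear systems\<close>

lemma card_eq_sum_fibres:
  assumes "finite A"
  shows "card A = (\<Sum>b\<in>f ` A. card {a\<in>A. f a = b})"
  using sum.image_gen[OF assms, of "\<lambda>_. 1::nat" f] by simp

lemma card_mult_fibres:
  assumes "finite A" and "\<And>b. b \<in> f ` A \<Longrightarrow> card {a\<in>A. f a = b} = n"
  shows "card A = card (f ` A) * n"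
  using card_eq_sum_fibres[OF assms(1), of f] assms(2) by simp

text \<open>In the equation indexed by an \<open>x\<close> of maximal \<open>sz\<close> only the
  diagonal coefficient survives, so this equation alone fixes \<open>\<alpha> x\<close>.
  Substituting the value changes nothing but the right-hand sides of the other equations, hence the
  induction over arbitrary \<open>f\<close>.\<close>

lemma triangular_system_unique_solution:
  fixes M :: "'c \<Rightarrow> 'c \<Rightarrow> 'k::field" and sz :: "'c \<Rightarrow> nat"
  assumes "finite S" and "\<And>c. c \<in> S \<Longrightarrow> M c c \<noteq> 0"
    and "\<And>c d. c \<in> S \<Longrightarrow> d \<in> S \<Longrightarrow> c \<noteq> d \<Longrightarrow> M c d \<noteq> 0 \<Longrightarrow> sz d < sz c"
  shows "\<exists>!\<alpha>. (\<forall>c. c \<notin> S \<longrightarrow> \<alpha> c = 0) \<and> (\<forall>d\<in>S. f d = (\<Sum>c\<in>S. \<alpha> c * M c d))"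
  using assms
proof (induction S arbitrary: f rule: finite_ranking_induct[where f = sz])
  case empty
  then show ?case by (intro ex1I[of _ "\<lambda>_. 0"]) auto
next
  case (insert x S)
  show ?case
  proof (cases "x \<in> S")
    case True
    then show ?thesis using insert by (simp add: insert_absorb)
  next
    case False
    have Mx: "M c x = 0" if "c \<in> S" for c
      using insert.prems(2)[of c x] insert.hyps(2)[OF that] that False by force
    define \<xi> where "\<xi> = f x / M x x"
    have xi: "\<xi> * M x x = f x" using insert.prems(1) by (simp add: \<xi>_def)
    have sum: "(\<Sum>c\<in>insert x S. \<alpha> c * M c d) = \<alpha> x * M x d + (\<Sum>c\<in>S. \<alpha> c * M c d)" for \<alpha> d
      using insert.hyps(1) False by simp
    have sumx: "(\<Sum>c\<in>insert x S. \<alpha> c * M c x) = \<alpha> x * M x x" for \<alpha>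
      using sum[of \<alpha> x] Mx by simp
    have upd: "(\<Sum>c\<in>S. (\<alpha>(x := t)) c * M c d) = (\<Sum>c\<in>S. \<alpha> c * M c d)" for \<alpha> t d
      using False by (intro sum.cong) auto
    have "\<exists>!\<beta>. (\<forall>c. c \<notin> S \<longrightarrow> \<beta> c = 0) \<and> (\<forall>d\<in>S. f d - \<xi> * M x d = (\<Sum>c\<in>S. \<beta> c * M c d))"
      using insert.prems by (intro insert.IH) auto
    then obtain \<beta> where \<beta>: "\<And>c. c \<notin> S \<Longrightarrow> \<beta> c = 0" "\<And>d. d \<in> S \<Longrightarrow> f d - \<xi> * M x d = (\<Sum>c\<in>S. \<beta> c * M c d)"
      and uniq: "\<And>\<gamma>. (\<forall>c. c \<notin> S \<longrightarrow> \<gamma> c = 0) \<and> (\<forall>d\<in>S. f d - \<xi> * M x d = (\<Sum>c\<in>S. \<gamma> c * M c d)) \<Longrightarrow> \<gamma> = \<beta>"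
      by (elim ex1E) blast
    show ?thesis
    proof (rule ex1I[of _ "\<beta>(x := \<xi>)"], intro conjI allI impI ballI)
      fix c assume "c \<notin> insert x S"
      then show "(\<beta>(x := \<xi>)) c = 0" using \<beta>(1) by auto
    next
      fix d assume "d \<in> insert x S"
      then show "f d = (\<Sum>c\<in>insert x S. (\<beta>(x := \<xi>)) c * M c d)"
        using sumx[of "\<beta>(x := \<xi>)"] xi sum[of "\<beta>(x := \<xi>)" d] upd[of \<beta> \<xi> d] \<beta>(2)[of d]
        by (cases "d = x") (auto simp: algebra_simps)
    next
      fix \<alpha> assume \<alpha>: "(\<forall>c. c \<notin> insert x S \<longrightarrow> \<alpha> c = 0) \<and> (\<forall>d\<in>insert x S. f d = (\<Sum>c\<in>insert x S. \<alpha> c * M c d))"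
      then have "f x = \<alpha> x * M x x" using sumx[of \<alpha>] by simp
      then have ax: "\<alpha> x = \<xi>" using insert.prems(1)[of x] by (simp add: \<xi>_def)
      \<comment> \<open>The uniqueness clause of the induction hypothesis includes vanishing outside
        \<open>S\<close>, so the value at \<open>x\<close> is reset to 0 before comparing.\<close>
      have "\<alpha>(x := 0) = \<beta>"
      proof (rule uniq, intro conjI allI impI ballI)
        fix c assume "c \<notin> S"
        then show "(\<alpha>(x := 0)) c = 0" using \<alpha> by auto
      next
        fix d assume d: "d \<in> S"
        then have "f d = \<alpha> x * M x d + (\<Sum>c\<in>S. \<alpha> c * M c d)" using \<alpha> sum[of \<alpha> d] by auto
        then show "f d - \<xi> * M x d = (\<Sum>c\<in>S. (\<alpha>(x := 0)) c * M c d)" using ax upd[of \<alpha> 0 d] by simp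
      qed
      then show "\<alpha> = \<beta>(x := \<xi>)" using ax by auto
    qed
  qed
qed

subsection \<open>The p-part of an element\<close>

locale finite_group_prime = group G for G (structure) +
  fixes p :: nat
  assumes finite_carrier: "finite (carrier G)" and prime_p: "prime p"
begin

text \<open>
  By the choice of \<open>expo\<close>, the power \<open>pp x\<close> is the p-part of \<open>x\<close>, simultaneously for all
  elements: \<open>pp x = x\<close> characterises the p-elements and \<open>pp x = \<one>\<close> the p-regular ones.
\<close>
definition expo :: nat where
  "expo = (SOME e. [e = 1] (mod p ^ multiplicity p (order G)) \<and>
     [e = 0] (mod order G div p ^ multiplicity p (order G)))"

definition pp :: "'a \<Rightarrow> 'a" where "pp x = x [^] expo"

lemma order_pos: "order G > 0"
  using finite_carrier order_gt_0_iff_finite by blast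

lemma p_gt_1: "p > 1"
  using prime_p prime_gt_1_nat by blast

lemma split_p_part:
  assumes "n > 0"
  obtains k s where "n = p ^ k * s" "\<not> p dvd s" "k = multiplicity p n"
    "s = n div p ^ k"
proof -
  have "\<not> p dvd n div p ^ multiplicity p n"
    using multiplicity_decompose[of n p] assms p_gt_1 by auto
  moreover have "n = p ^ multiplicity p n * (n div p ^ multiplicity p n)"
    by (simp add: multiplicity_dvd)
  ultimately show ?thesis using that by blast
qed

lemma coprime_p_power: "\<not> p dvd s \<Longrightarrow> coprime (p ^ k) s"
  using prime_p by (simp add: prime_imp_coprime)

lemma expo_spec:
  "[expo = 1] (mod p ^ multiplicity p (order G))"
  "[expo = 0] (mod order G div p ^ multiplicity p (order G))"
proof -
  obtain k s where ks: "order G = p ^ k * s" "\<not> p dvd s" "k = multiplicity p (order G)"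
    "s = order G div p ^ k"
    using split_p_part order_pos by metis
  have "\<exists>e. [e = 1] (mod p ^ k) \<and> [e = 0] (mod s)"
    using binary_chinese_remainder_nat[OF coprime_p_power[OF ks(2)]] by blast
  then show "[expo = 1] (mod p ^ multiplicity p (order G))"
    "[expo = 0] (mod order G div p ^ multiplicity p (order G))"
    unfolding expo_def ks(4) ks(3) by (metis (mono_tags, lifting) someI_ex)+
qed

lemma ord_pos: "x \<in> carrier G \<Longrightarrow> ord x > 0"
  using ord_ge_1[OF finite_carrier] by fastforce

lemma pp_closed [simp, intro]: "x \<in> carrier G \<Longrightarrow> pp x \<in> carrier G"
  by (simp add: pp_def)

lemma subgroup_pow_closed: "subgroup H G \<Longrightarrow> x \<in> H \<Longrightarrow> x [^] (n::nat) \<in> H"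
  by (induction n) (auto simp: subgroup.one_closed subgroup.m_closed)

lemma pp_in_subgroup: "subgroup H G \<Longrightarrow> x \<in> H \<Longrightarrow> pp x \<in> H"
  by (simp add: pp_def subgroup_pow_closed)

lemma pp_mult:
  "x \<otimes> y = y \<otimes> x \<Longrightarrow> x \<in> carrier G \<Longrightarrow> y \<in> carrier G \<Longrightarrow> pp (x \<otimes> y) = pp x \<otimes> pp y"
  unfolding pp_def by (rule pow_mult_distrib)

lemma pp_inv: "x \<in> carrier G \<Longrightarrow> pp (inv x) = inv (pp x)"
  by (simp add: pp_def nat_pow_inv)

lemma pow_conj:
  assumes "g \<in> carrier G" "x \<in> carrier G"
  shows "(g \<otimes> x \<otimes> inv g) [^] (n::nat) = g \<otimes> x [^] n \<otimes> inv g"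
proof (induction n)
  case (Suc n)
  have "inv g \<otimes> (g \<otimes> (x \<otimes> inv g)) = x \<otimes> inv g"
    using assms by (simp flip: m_assoc)
  then show ?case using Suc assms by (simp add: m_assoc)
qed (use assms in simp)

lemma conj_inj_on: "g \<in> carrier G \<Longrightarrow> inj_on (\<lambda>x. g \<otimes> x \<otimes> inv g) (carrier G)"
  by (simp add: inj_on_def)

lemma ord_conj:
  assumes "g \<in> carrier G" "x \<in> carrier G"
  shows "ord (g \<otimes> x \<otimes> inv g) = ord x"
proof -
  have "g \<otimes> x [^] n \<otimes> inv g = \<one> \<longleftrightarrow> x [^] n = \<one>" for n :: nat
    using inj_on_eq_iff[OF conj_inj_on[OF assms(1)], of "x [^] n" \<one>] assms by simp
  then show ?thesis
    using assms by (subst ord_unique) (auto simp: pow_conj pow_eq_id)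
qed

lemma pp_conj: "g \<in> carrier G \<Longrightarrow> x \<in> carrier G \<Longrightarrow> pp (g \<otimes> x \<otimes> inv g) = g \<otimes> pp x \<otimes> inv g"
  by (simp add: pp_def pow_conj)

text \<open>\<open>expo\<close> is divisible by the p'-part of \<open>ord x\<close> and prime to its
  p-part, so raising to this power removes exactly the p'-part of the order.\<close>

lemma ord_pp:
  assumes x: "x \<in> carrier G"
  shows "ord (pp x) = p ^ multiplicity p (ord x)"
proof -
  obtain k s where ks: "ord x = p ^ k * s" "\<not> p dvd s" "k = multiplicity p (ord x)"
    using split_p_part ord_pos[OF x] by metis
  obtain a m where am: "order G = p ^ a * m" "\<not> p dvd m" "a = multiplicity p (order G)"
    "m = order G div p ^ a"
    using split_p_part order_pos by metis
  have dvd: "ord x dvd order G" using ord_dvd_group_order x by blast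
  have "s dvd p ^ a * m" using dvd ks am by (metis dvd_mult_right)
  then have "s dvd m"
    using coprime_p_power[OF ks(2), of a] by (metis coprime_commute coprime_dvd_mult_right_iff)
  then have se: "s dvd expo"
    using expo_spec(2) am by (metis cong_0_iff dvd_trans)
  have ka: "k \<le> a" unfolding ks(3) am(3) using dvd order_pos by (intro dvd_imp_multiplicity_le) auto
  have cop: "coprime (p ^ k) expo"
  proof (cases "k = 0")
    case False
    have "[expo = 1] (mod p ^ k)"
      using expo_spec(1) am ka by (metis cong_dvd_modulus_nat le_imp_power_dvd)
    then show ?thesis by (metis cong_imp_coprime cong_sym coprime_1_left coprime_commute)
  qed simp
  have "pp x [^] n = \<one> \<longleftrightarrow> p ^ k dvd n" for n :: nat
  proof -
    have "pp x [^] n = \<one> \<longleftrightarrow> p ^ k * s dvd expo * n"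
      using x by (simp add: pp_def nat_pow_pow pow_eq_id ks(1))
    also have "\<dots> \<longleftrightarrow> p ^ k dvd expo * n"
      using se coprime_p_power[OF ks(2), of k] by (meson divides_mult dvd_mult2 dvd_mult_left)
    also have "\<dots> \<longleftrightarrow> p ^ k dvd n"
      using cop by (simp add: coprime_dvd_mult_right_iff)
    finally show ?thesis .
  qed
  then show ?thesis unfolding ks(3)[symmetric] using x ord_unique pp_closed by blast
qed

lemma pp_eq_one_iff: "x \<in> carrier G \<Longrightarrow> pp x = \<one> \<longleftrightarrow> \<not> p dvd ord x"
  using ord_eq_1[of "pp x"] ord_pp[of x] ord_pos[of x] p_gt_1
  by (auto simp: multiplicity_eq_zero_iff)

lemma pp_eq_self:
  assumes x: "x \<in> carrier G" and "ord x = p ^ k"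
  shows "pp x = x"
proof -
  have "p ^ k dvd order G" using assms ord_dvd_group_order by metis
  then have "k \<le> multiplicity p (order G)"
    using order_pos p_gt_1 by (simp add: power_dvd_iff_le_multiplicity)
  then have "[expo = 1] (mod ord x)"
    using expo_spec(1) assms by (metis cong_dvd_modulus_nat le_imp_power_dvd)
  then have "int (ord x) dvd 1 - int expo"
    by (metis cong_iff_dvd_diff cong_int_iff cong_sym of_nat_1)
  then have "x [^] (int expo) = x [^] (1::int)"
    using int_pow_eq x by blast
  then show ?thesis using x by (simp add: pp_def int_pow_int)
qed

lemma pp_idem: "x \<in> carrier G \<Longrightarrow> pp (pp x) = pp x"
  using pp_eq_self ord_pp pp_closed by blast

lemma pp_self_iff: "x \<in> carrier G \<Longrightarrow> pp x = x \<longleftrightarrow> (\<exists>k. ord x = p ^ k)"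
  using pp_eq_self ord_pp by metis

lemma pp_one [simp]: "pp \<one> = \<one>"
  by (simp add: pp_def)

lemma pp_commute: "x \<in> carrier G \<Longrightarrow> pp x \<otimes> x = x \<otimes> pp x"
  unfolding pp_def using nat_pow_comm[of x expo 1] by simp

section \<open>Conjugacy classes, centralisers and p-sections\<close>

definition cls :: "'a set \<Rightarrow> 'a \<Rightarrow> 'a set" where
  "cls H y = (\<lambda>h. h \<otimes> y \<otimes> inv h) ` H"

definition cent :: "'a set \<Rightarrow> 'a \<Rightarrow> 'a set" where
  "cent H y = {h \<in> H. h \<otimes> y = y \<otimes> h}"

definition reg :: "'a set \<Rightarrow> 'a set" where
  "reg H = {h \<in> H. pp h = \<one>}"

text \<open>For a p-element \<open>y\<close> of \<open>H\<close> this is the p-section of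
  \<open>y\<close>. The p-sections partition \<open>H\<close>, and counts modulo the p'-part of the
  order go section by section.\<close>

definition fibre :: "'a set \<Rightarrow> 'a \<Rightarrow> 'a set" where
  "fibre H y = {g \<in> H. pp g \<in> cls H y}"

lemma subgroup_finite: "subgroup H G \<Longrightarrow> finite H"
  using finite_carrier subgroup.subset finite_subset by metis

lemma cent_subgroup:
  assumes "subgroup H G" "y \<in> carrier G"
  shows "subgroup (cent H y) G"
proof (rule subgroupI)
  show "cent H y \<subseteq> carrier G" using assms subgroup.subset by (auto simp: cent_def)
  show "cent H y \<noteq> {}" using assms by (auto simp: cent_def subgroup.one_closed intro!: exI[of _ \<one>])
next
  fix a assume "a \<in> cent H y"
  then show "inv a \<in> cent H y"
    using assms subgroup.mem_carrier[OF assms(1)]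
    by (auto simp: cent_def subgroup.m_inv_closed) (metis inv_closed inv_solve_left inv_solve_right m_assoc m_closed)
next
  fix a b assume "a \<in> cent H y" "b \<in> cent H y"
  then show "a \<otimes> b \<in> cent H y"
    using assms subgroup.mem_carrier[OF assms(1)]
    by (auto simp: cent_def subgroup.m_closed) (metis m_assoc)
qed

lemma conj_eq_iff:
  assumes "g \<in> carrier G" "x \<in> carrier G" "z \<in> carrier G"
  shows "g \<otimes> x \<otimes> inv g = z \<longleftrightarrow> g \<otimes> x = z \<otimes> g"
  using assms by (metis inv_solve_right m_closed)

lemma conj_conj:
  assumes "g \<in> carrier G" "h \<in> carrier G" "x \<in> carrier G"
  shows "g \<otimes> (h \<otimes> x \<otimes> inv h) \<otimes> inv g = (g \<otimes> h) \<otimes> x \<otimes> inv (g \<otimes> h)"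
  using assms by (simp add: m_assoc inv_mult_group)

lemma conj_inv_conj:
  assumes "g \<in> carrier G" "x \<in> carrier G"
  shows "inv g \<otimes> (g \<otimes> x \<otimes> inv g) \<otimes> g = x"
  using conj_conj[of "inv g" g x] assms by simp

lemma cls_subset: "subgroup H G \<Longrightarrow> y \<in> H \<Longrightarrow> cls H y \<subseteq> H"
  by (auto simp: cls_def subgroup.m_closed subgroup.m_inv_closed)

lemma self_in_cls: "subgroup H G \<Longrightarrow> y \<in> carrier G \<Longrightarrow> y \<in> cls H y"
  unfolding cls_def by (rule image_eqI[of _ _ \<one>]) (auto simp: subgroup.one_closed)

lemma cls_eq:
  assumes "subgroup H G" "y \<in> carrier G" "z \<in> cls H y"
  shows "cls H z = cls H y"
proof -
  have sub: "cls H z \<subseteq> cls H y" if yz: "y \<in> carrier G" "z \<in> cls H y" for y z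
  proof
    fix w assume "w \<in> cls H z"
    then obtain g h where "g \<in> H" "h \<in> H" "w = g \<otimes> (h \<otimes> y \<otimes> inv h) \<otimes> inv g"
      using yz(2) unfolding cls_def by blast
    then show "w \<in> cls H y" unfolding cls_def
      using subgroup.mem_carrier[OF assms(1)] subgroup.m_closed[OF assms(1)] conj_conj yz
      by (intro image_eqI[of _ _ "g \<otimes> h"]) auto
  qed
  obtain h where h: "h \<in> H" "z = h \<otimes> y \<otimes> inv h" using assms by (auto simp: cls_def)
  have "y \<in> cls H z" unfolding cls_def
    using h conj_inv_conj[of h y] assms subgroup.mem_carrier[OF assms(1)] subgroup.m_inv_closed[OF assms(1)]
    by (intro image_eqI[of _ _ "inv h"]) auto
  moreover have "z \<in> carrier G" using h assms subgroup.mem_carrier[OF assms(1)] by auto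
  ultimately show ?thesis using sub assms by blast
qed

text \<open>Orbit-stabiliser: the fibres of the map sending h to h y h^-1 are left cosets of the
  centraliser.\<close>

lemma card_cls:
  assumes H: "subgroup H G" and y: "y \<in> carrier G"
  shows "card (cls H y) * card (cent H y) = card H"
proof -
  note Hc = subgroup.mem_carrier[OF H]
  have "card {a \<in> H. a \<otimes> y \<otimes> inv a = b} = card (cent H y)"
    if "b \<in> (\<lambda>h. h \<otimes> y \<otimes> inv h) ` H" for b
  proof -
    obtain h where h: "h \<in> H" "b = h \<otimes> y \<otimes> inv h" using \<open>b \<in> _\<close> by auto
    have "{a \<in> H. a \<otimes> y \<otimes> inv a = b} = (\<lambda>c. h \<otimes> c) ` cent H y"
    proof (intro equalityI subsetI)
      fix a assume "a \<in> {a \<in> H. a \<otimes> y \<otimes> inv a = b}"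
      then have a: "a \<in> H" "a \<otimes> y \<otimes> inv a = h \<otimes> y \<otimes> inv h" using h by auto
      have "inv h \<otimes> a \<otimes> y \<otimes> inv (inv h \<otimes> a) = y"
        using a h Hc y conj_conj[of "inv h" a y] conj_inv_conj[of h y] by simp
      then have "inv h \<otimes> a \<in> cent H y"
        using a h Hc y H by (auto simp: cent_def conj_eq_iff subgroup.m_closed subgroup.m_inv_closed)
      moreover have "a = h \<otimes> (inv h \<otimes> a)" using a h Hc by (simp flip: m_assoc)
      ultimately show "a \<in> (\<lambda>c. h \<otimes> c) ` cent H y" by blast
    next
      fix a assume "a \<in> (\<lambda>c. h \<otimes> c) ` cent H y"
      then obtain c where c: "c \<in> H" "c \<otimes> y \<otimes> inv c = y" "a = h \<otimes> c"
        using Hc y by (auto simp: cent_def conj_eq_iff)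
      then show "a \<in> {a \<in> H. a \<otimes> y \<otimes> inv a = b}"
        using h Hc y H conj_conj[of h c y] by (auto simp: subgroup.m_closed)
    qed
    moreover have "inj_on (\<lambda>c. h \<otimes> c) (cent H y)"
      using h Hc by (auto simp: inj_on_def cent_def)
    ultimately show ?thesis by (simp add: card_image)
  qed
  from card_mult_fibres[OF subgroup_finite[OF H] this] show ?thesis
    unfolding cls_def by (rule sym)
qed

text \<open>An element with p-part exactly \<open>y\<close> is \<open>y \<otimes> r\<close> for a
  unique p-regular \<open>r\<close> commuting with \<open>y\<close>. Conjugation carries these
  elements to those with any other p-part in the class, so all fibres of \<open>pp\<close> over the
  class have the same size.\<close>

lemma card_fibre:
  assumes H: "subgroup H G" and y: "y \<in> H" "pp y = y"
  shows "card (fibre H y) = card (cls H y) * card (reg (cent H y))"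
proof -
  note Hc = subgroup.mem_carrier[OF H]
  have 1: "{g \<in> H. pp g = y} = (\<lambda>r. y \<otimes> r) ` reg (cent H y)"
  proof (intro equalityI subsetI)
    fix g assume "g \<in> {g \<in> H. pp g = y}"
    then have g: "g \<in> H" "pp g = y" by auto
    have c: "g \<otimes> y = y \<otimes> g" using pp_commute[of g] g Hc by simp
    have c': "inv y \<otimes> g = g \<otimes> inv y"
      using c g y Hc by (metis inv_closed inv_solve_left inv_solve_right m_assoc m_closed)
    have "pp (inv y \<otimes> g) = \<one>"
      using pp_mult[OF c'] g y Hc pp_inv by simp
    moreover have "inv y \<otimes> g \<otimes> y = y \<otimes> (inv y \<otimes> g)"
      using c c' g y Hc by (metis inv_closed m_assoc l_inv l_one r_inv)
    ultimately have "inv y \<otimes> g \<in> reg (cent H y)"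
      using g y H by (auto simp: reg_def cent_def subgroup.m_closed subgroup.m_inv_closed)
    moreover have "g = y \<otimes> (inv y \<otimes> g)" using g y Hc by (simp flip: m_assoc)
    ultimately show "g \<in> (\<lambda>r. y \<otimes> r) ` reg (cent H y)" by blast
  next
    fix g assume "g \<in> (\<lambda>r. y \<otimes> r) ` reg (cent H y)"
    then obtain r where r: "r \<in> H" "r \<otimes> y = y \<otimes> r" "pp r = \<one>" "g = y \<otimes> r"
      by (auto simp: reg_def cent_def)
    then show "g \<in> {g \<in> H. pp g = y}"
      using pp_mult[of y r] y Hc H by (auto simp: subgroup.m_closed)
  qed
  have inj: "inj_on (\<lambda>r. y \<otimes> r) (reg (cent H y))"
    using y Hc by (auto simp: inj_on_def cent_def reg_def)
  have 2: "card {g \<in> H. pp g = z} = card (reg (cent H y))" if "z \<in> cls H y" for z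
  proof -
    obtain h where h: "h \<in> H" "z = h \<otimes> y \<otimes> inv h" using \<open>z \<in> _\<close> by (auto simp: cls_def)
    have "{g \<in> H. pp g = z} = (\<lambda>g. h \<otimes> g \<otimes> inv h) ` {g \<in> H. pp g = y}"
    proof (intro equalityI subsetI)
      fix g assume "g \<in> {g \<in> H. pp g = z}"
      then have g: "g \<in> H" "pp g = z" by auto
      have "inv h \<otimes> g \<otimes> h \<in> H" using g h H by (simp add: subgroup.m_closed subgroup.m_inv_closed)
      moreover have "pp (inv h \<otimes> g \<otimes> h) = y"
        using pp_conj[of "inv h" g] g h y Hc conj_inv_conj[of h y] by simp
      moreover have "g = h \<otimes> (inv h \<otimes> g \<otimes> h) \<otimes> inv h"
        using conj_conj[of h "inv h" g] g h Hc by simp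
      ultimately show "g \<in> (\<lambda>g. h \<otimes> g \<otimes> inv h) ` {g \<in> H. pp g = y}" by blast
    next
      fix g assume "g \<in> (\<lambda>g. h \<otimes> g \<otimes> inv h) ` {g \<in> H. pp g = y}"
      then show "g \<in> {g \<in> H. pp g = z}"
        using h Hc H pp_conj by (auto simp: subgroup.m_closed subgroup.m_inv_closed)
    qed
    moreover have "inj_on (\<lambda>g. h \<otimes> g \<otimes> inv h) {g \<in> H. pp g = y}"
      using conj_inj_on[of h] h Hc by (auto intro: inj_on_subset)
    ultimately show ?thesis using 1 inj by (simp add: card_image)
  qed
  have fin: "finite (fibre H y)" using subgroup_finite[OF H] by (simp add: fibre_def)
  have im: "pp ` fibre H y = cls H y"
  proof (intro equalityI subsetI)
    fix z assume z: "z \<in> cls H y"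
    have "z \<in> H" using cls_subset[OF H] y z by blast
    moreover have "pp z = z"
      using z y Hc pp_conj by (auto simp: cls_def)
    ultimately show "z \<in> pp ` fibre H y"
      using z by (intro image_eqI[of _ _ z]) (auto simp: fibre_def)
  qed (auto simp: fibre_def)
  have "{a \<in> fibre H y. pp a = z} = {g \<in> H. pp g = z}" if "z \<in> cls H y" for z
    using that by (auto simp: fibre_def)
  then show ?thesis
    using card_mult_fibres[OF fin, of pp "card (reg (cent H y))"] im 2 by auto
qed


subsection \<open>Frobenius divisibility\<close>

lemma ord_dvd_card:
  assumes "subgroup H G" "x \<in> H"
  shows "ord x dvd card H"
proof -
  interpret H: group "G\<lparr>carrier := H\<rparr>"
    using assms(1) subgroup.subgroup_is_group is_group by blast
  have "x [^]\<^bsub>G\<lparr>carrier := H\<rparr>\<^esub> order (G\<lparr>carrier := H\<rparr>) = \<one>\<^bsub>G\<lparr>carrier := H\<rparr>\<^esub>"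
    using assms by (intro H.pow_order_eq_1) simp
  then have "x [^] card H = \<one>"
    by (simp add: order_def flip: nat_pow_consistent)
  then show ?thesis using assms pow_eq_id subgroup.mem_carrier by metis
qed

lemma card_subgroup_pos: "subgroup H G \<Longrightarrow> card H > 0"
  using subgroup_finite[of H] subgroup.one_closed[of H G] card_gt_0_iff[of H] by blast

lemma sylow_subgroup_exists:
  assumes "subgroup H G" "prime q" "q ^ k dvd card H"
  obtains P where "subgroup P G" "P \<subseteq> H" "card P = q ^ k"
proof -
  have gr: "group (G\<lparr>carrier := H\<rparr>)"
    using assms(1) subgroup.subgroup_is_group is_group by blast
  obtain m where "card H = q ^ k * m" using assms by auto
  then obtain P where P: "subgroup P (G\<lparr>carrier := H\<rparr>)" "card P = q ^ k"
    using sylow_thm[OF assms(2) gr, of k m] subgroup_finite[OF assms(1)] by (auto simp: order_def)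
  moreover have "subgroup P G" using P(1) assms(1) incl_subgroup by blast
  moreover have "P \<subseteq> H" using subgroup.subset[OF P(1)] by simp
  ultimately show ?thesis using that by blast
qed

text \<open>A form of Cauchy's theorem. The prime \<open>q\<close> is arbitrary because it will be
  applied to primes different from \<open>p\<close>.\<close>

lemma exists_prime_power_order:
  assumes "subgroup H G" "prime q" "q dvd card H"
  obtains x k where "x \<in> H" "x \<noteq> \<one>" "ord x = q ^ k"
proof -
  obtain P where P: "subgroup P G" "P \<subseteq> H" "card P = q ^ 1"
    using sylow_subgroup_exists[of H q 1] assms by auto
  have "\<not> P \<subseteq> {\<one>}"
  proof
    assume "P \<subseteq> {\<one>}"
    then have "card P \<le> 1" using card_mono[of "{\<one>}" P] by simp
    then show False using P prime_gt_1_nat[OF assms(2)] by simp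
  qed
  then obtain x where x: "x \<in> P" "x \<noteq> \<one>" by blast
  have "ord x dvd q ^ 1" using ord_dvd_card[OF P(1) x(1)] P by simp
  then obtain k where "ord x = q ^ k" using divides_primepow_nat[OF assms(2)] by blast
  then show ?thesis using that x P by blast
qed

section \<open>The p-part and the p'-part of a group order\<close>

definition ppart :: "'a set \<Rightarrow> nat" where
  "ppart H = p ^ multiplicity p (card H)"

definition preg :: "'a set \<Rightarrow> nat" where
  "preg H = card H div ppart H"

lemma card_split: "card H = ppart H * preg H"
  unfolding preg_def ppart_def by (simp add: multiplicity_dvd)

lemma preg_pos: "subgroup H G \<Longrightarrow> preg H > 0"
  using card_subgroup_pos[of H] card_split[of H] by simp

lemma preg_not_dvd: "subgroup H G \<Longrightarrow> \<not> p dvd preg H"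
  unfolding preg_def ppart_def
  using multiplicity_decompose[of "card H" p] card_subgroup_pos[of H] p_gt_1 by simp

text \<open>Transfers divisibility from a centraliser \<open>K\<close> to the group
  \<open>H\<close>; \<open>c\<close> will be the length of the conjugacy class.\<close>

lemma preg_dvd_mult:
  assumes "subgroup H G" "subgroup K G" "c * card K = card H"
  shows "preg H dvd c * preg K"
proof -
  have "preg H dvd ppart K * (c * preg K)"
    using assms(3) card_split[of H] card_split[of K] by (metis dvd_triv_right mult.left_commute)
  moreover have "coprime (preg H) (ppart K)"
    using coprime_p_power[OF preg_not_dvd[OF assms(1)]] by (simp add: ppart_def coprime_commute)
  ultimately show ?thesis by (simp add: coprime_dvd_mult_right_iff)
qed

text \<open>For the whole group the cardinality of this set is N_j; for \<open>j = 0\<close> it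
  consists of the p-regular elements.\<close>

definition upto_part :: "'a set \<Rightarrow> nat \<Rightarrow> 'a set" where
  "upto_part H j = {g \<in> H. multiplicity p (ord g) \<le> j}"

lemma upto_part_0: "subgroup H G \<Longrightarrow> upto_part H 0 = reg H"
proof -
  assume H: "subgroup H G"
  have "multiplicity p (ord g) = 0 \<longleftrightarrow> pp g = \<one>" if "g \<in> H" for g
    using pp_eq_one_iff[of g] ord_pos[of g] subgroup.mem_carrier[OF H that] p_gt_1
    by (simp add: multiplicity_eq_zero_iff)
  then show ?thesis by (auto simp: upto_part_def reg_def)
qed

lemma one_in_upto_part: "subgroup H G \<Longrightarrow> \<one> \<in> upto_part H j"
  by (simp add: upto_part_def subgroup.one_closed)

lemma fibre_disjoint:
  assumes "subgroup H G" "y \<in> H" "z \<in> H" "fibre H y \<inter> fibre H z \<noteq> {}"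
  shows "fibre H y = fibre H z"
proof -
  obtain g where "pp g \<in> cls H y" "pp g \<in> cls H z" using assms(4) by (auto simp: fibre_def)
  then have "cls H y = cls H z"
    using cls_eq[OF assms(1)] assms subgroup.mem_carrier[OF assms(1)] by metis
  then show ?thesis by (simp add: fibre_def)
qed

lemma self_in_fibre: "subgroup H G \<Longrightarrow> g \<in> H \<Longrightarrow> g \<in> fibre H (pp g)"
  using self_in_cls[of H "pp g"] subgroup.mem_carrier[of H G g] by (simp add: fibre_def)

lemma fibre_pp_cases:
  assumes H: "subgroup H G" and "y \<in> H" "g \<in> fibre H y"
  obtains h where "h \<in> H" "pp g = h \<otimes> y \<otimes> inv h" "g \<in> H"
  using assms by (auto simp: fibre_def cls_def)

text \<open>The central p-elements form a subgroup, because \<open>pp\<close> is multiplicative on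
  commuting elements. A common prime divisor of its order and \<open>preg H\<close> would by Cauchy
  yield a nontrivial element that is a p-element and p-regular at once. The coprimality lets the
  factor \<open>card Z\<close> be cancelled in Frobenius' count.\<close>

lemma central_p_elements_card:
  assumes H: "subgroup H G"
  shows "coprime (card {y \<in> H. pp y = y \<and> cent H y = H}) (preg H)"
proof -
  define Z where "Z = {y \<in> H. pp y = y \<and> cent H y = H}"
  note Hc = subgroup.mem_carrier[OF H]
  have comm: "h \<otimes> y = y \<otimes> h" if "y \<in> Z" "h \<in> H" for y h
    using that by (auto simp: Z_def cent_def)
  have ZI: "y \<in> Z" if "y \<in> H" "pp y = y" "\<And>h. h \<in> H \<Longrightarrow> h \<otimes> y = y \<otimes> h" for y
    using that by (auto simp: Z_def cent_def)
  have ZH: "Z \<subseteq> H" and Zp: "\<And>y. y \<in> Z \<Longrightarrow> pp y = y" by (auto simp: Z_def)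
  have "subgroup Z G"
  proof (rule subgroupI)
    show "Z \<subseteq> carrier G" using ZH Hc by blast
    have "\<one> \<in> Z" using H Hc by (intro ZI) (auto simp: subgroup.one_closed)
    then show "Z \<noteq> {}" by blast
  next
    fix a assume a: "a \<in> Z"
    then have aH: "a \<in> H" using ZH by blast
    show "inv a \<in> Z"
    proof (rule ZI)
      show "inv a \<in> H" using aH H by (simp add: subgroup.m_inv_closed)
      show "pp (inv a) = inv a" using pp_inv Zp[OF a] aH Hc by simp
      show "h \<otimes> inv a = inv a \<otimes> h" if "h \<in> H" for h
        using comm[OF a that] aH Hc that
        by (metis inv_closed inv_solve_left inv_solve_right m_assoc m_closed)
    qed
  next
    fix a b assume ab: "a \<in> Z" "b \<in> Z"
    then have abH: "a \<in> H" "b \<in> H" using ZH by blast+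
    show "a \<otimes> b \<in> Z"
    proof (rule ZI)
      show "a \<otimes> b \<in> H" using abH H by (simp add: subgroup.m_closed)
      show "pp (a \<otimes> b) = a \<otimes> b"
        using pp_mult[OF comm[OF ab(2) abH(1)]] Zp ab abH Hc by simp
      show "h \<otimes> (a \<otimes> b) = a \<otimes> b \<otimes> h" if "h \<in> H" for h
        using comm[OF ab(1) that] comm[OF ab(2) that] abH Hc that by (metis m_assoc)
    qed
  qed
  show ?thesis
  proof (fold Z_def, rule ccontr)
    assume "\<not> coprime (card Z) (preg H)"
    then obtain q where q: "prime q" "q dvd card Z" "q dvd preg H"
      using prime_factor_nat[of "gcd (card Z) (preg H)"] by (auto simp: coprime_iff_gcd_eq_1)
    obtain x k where x: "x \<in> Z" "x \<noteq> \<one>" "ord x = q ^ k"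
      using exists_prime_power_order[OF \<open>subgroup Z G\<close> q(1,2)] by blast
    have xc: "x \<in> carrier G" using x ZH Hc by blast
    have "q \<noteq> p" using q(3) preg_not_dvd[OF H] by blast
    then have "\<not> p dvd ord x"
      using x(3) prime_p q(1) by (metis prime_dvd_power primes_dvd_imp_eq)
    then have "pp x = \<one>" using pp_eq_one_iff[OF xc] by blast
    then show False using Zp[OF x(1)] x(2) by simp
  qed
qed

text \<open>
  Frobenius' theorem for the number of p-regular elements: the noncentral p-parts contribute
  a multiple of the p'-part of the group order by induction, and each central one contributes
  the same number of elements.
\<close>
lemma preg_dvd_card_reg:
  assumes "subgroup H G"
  shows "preg H dvd card (reg H)"
  using assms
proof (induction "card H" arbitrary: H rule: less_induct)
  case less
  note H = less.prems
  note Hc = subgroup.mem_carrier[OF H]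
  define Z where "Z = {y \<in> H. pp y = y \<and> cent H y = H}"
  define A where "A = {g \<in> H. pp g \<in> Z}"
  define C where "C = fibre H ` {y \<in> H. pp y = y \<and> y \<notin> Z}"
  have finH: "finite H" using subgroup_finite[OF H] .
  \<comment> \<open>A conjugate of a noncentral element is noncentral, so the sections of the
    noncentral p-elements make up exactly the elements whose p-part is not central.\<close>
  have UC: "\<Union>C = H - A"
  proof (intro equalityI subsetI)
    fix g assume "g \<in> \<Union>C"
    then obtain y where y: "y \<in> H" "pp y = y" "y \<notin> Z" "g \<in> fibre H y" by (auto simp: C_def)
    then obtain h where h: "h \<in> H" "pp g = h \<otimes> y \<otimes> inv h" "g \<in> H"
      using fibre_pp_cases[OF H] by blast
    have "pp g \<notin> Z"
    proof
      assume "pp g \<in> Z"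
      then have "cent H (pp g) = H" by (simp add: Z_def)
      moreover have "inv h \<in> H" using h(1) H by (simp add: subgroup.m_inv_closed)
      ultimately have "inv h \<in> cent H (pp g)" by blast
      then have "inv h \<otimes> pp g = pp g \<otimes> inv h" unfolding cent_def by blast
      then have "inv h \<otimes> pp g \<otimes> h = pp g"
        using Hc[OF h(1)] Hc[OF h(3)] by (simp add: m_assoc)
      then have "y = pp g" using conj_inv_conj[of h y] Hc[OF h(1)] Hc[OF y(1)] h(2) by metis
      then show False using y \<open>pp g \<in> Z\<close> by simp
    qed
    then show "g \<in> H - A" using h by (auto simp: A_def)
  next
    fix g assume "g \<in> H - A"
    then show "g \<in> \<Union>C" unfolding C_def A_def
      using self_in_fibre[OF H, of g] pp_in_subgroup[OF H, of g] pp_idem[of g] Hc by auto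
  qed
  have "preg H dvd card (fibre H y)" if y: "y \<in> H" "pp y = y" "y \<notin> Z" for y
  proof -
    have sub: "subgroup (cent H y) G" using cent_subgroup H y Hc by blast
    have "cent H y \<subset> H" using y by (auto simp: Z_def cent_def)
    then have "card (cent H y) < card H" using finH by (rule psubset_card_mono[rotated])
    then have "preg (cent H y) dvd card (reg (cent H y))" using less.hyps sub by blast
    then have "card (cls H y) * preg (cent H y) dvd card (fibre H y)"
      using card_fibre[OF H y(1,2)] by simp
    then show ?thesis using preg_dvd_mult[OF H sub card_cls[OF H]] y Hc dvd_trans by blast
  qed
  then have "preg H dvd card (\<Union>C)"
    using finH UC unfolding C_def
    by (intro dvd_partition) (simp, blast, use fibre_disjoint[OF H] in blast)
  moreover have "card H = card A + card (\<Union>C)"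
  proof -
    have "A \<subseteq> H" by (auto simp: A_def)
    then show ?thesis
      unfolding UC using finH card_mono[of H A] by (simp add: card_Diff_subset finite_subset)
  qed
  moreover have "preg H dvd card H" using card_split[of H] by simp
  ultimately have dA: "preg H dvd card A" by (metis dvd_add_left_iff)
  have fib: "card {a \<in> A. pp a = y} = card (reg H)" if "y \<in> pp ` A" for y
  proof -
    have yZ: "y \<in> Z" using that by (auto simp: A_def)
    then have y: "y \<in> H" "pp y = y" "cent H y = H" by (auto simp: Z_def)
    have cy: "h \<otimes> y \<otimes> inv h = y" if "h \<in> H" for h
      using y that Hc by (auto simp: cent_def conj_eq_iff)
    then have "cls H y = {y}" using subgroup.one_closed[OF H] by (auto simp: cls_def)
    moreover have "{a \<in> A. pp a = y} = {a \<in> H. pp a = y}" using yZ by (auto simp: A_def)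
    ultimately show ?thesis
      using card_fibre[OF H y(1,2)] y(3) by (simp add: fibre_def)
  qed
  have "pp ` A = Z"
  proof (intro equalityI subsetI)
    fix y assume "y \<in> Z"
    then show "y \<in> pp ` A" by (intro image_eqI[of _ _ y]) (auto simp: A_def Z_def)
  qed (auto simp: A_def)
  then have "card A = card Z * card (reg H)"
    using card_mult_fibres[of A pp "card (reg H)"] fib finH by (auto simp: A_def)
  then have "preg H dvd card Z * card (reg H)" using dA by simp
  then show ?case
    using central_p_elements_card[OF H] by (simp add: Z_def coprime_commute coprime_dvd_mult_right_iff)
qed

lemma preg_dvd_card_fibre:
  assumes H: "subgroup H G" and "y \<in> H" "pp y = y"
  shows "preg H dvd card (fibre H y)"
proof -
  have sub: "subgroup (cent H y) G" using cent_subgroup assms subgroup.mem_carrier by metis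
  have "card (cls H y) * preg (cent H y) dvd card (fibre H y)"
    using card_fibre[OF assms] preg_dvd_card_reg[OF sub] by simp
  then show ?thesis
    using preg_dvd_mult[OF H sub card_cls[OF H]] assms subgroup.mem_carrier dvd_trans by metis
qed

lemma fibre_multiplicity:
  assumes H: "subgroup H G" and "y \<in> H" "pp y = y" "g \<in> fibre H y"
  shows "p ^ multiplicity p (ord g) = ord y"
proof -
  obtain h where "h \<in> H" "pp g = h \<otimes> y \<otimes> inv h" "g \<in> H" using fibre_pp_cases assms by metis
  then show ?thesis
    using ord_pp[of g] ord_conj[of h y] assms subgroup.mem_carrier[OF H] by metis
qed

text \<open>The valuation of the order depends only on the p-part, up to conjugacy, so a bound on it
  cuts out a union of p-sections.\<close>

lemma upto_part_eq_Union:
  assumes H: "subgroup H G"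
  shows "upto_part H j = \<Union> (fibre H ` {y \<in> H. pp y = y \<and> ord y \<le> p ^ j})"
proof (intro equalityI subsetI)
  fix g assume g: "g \<in> upto_part H j"
  then have "g \<in> H" "multiplicity p (ord g) \<le> j" by (auto simp: upto_part_def)
  moreover have "g \<in> carrier G" using \<open>g \<in> H\<close> H subgroup.mem_carrier by metis
  ultimately show "g \<in> \<Union> (fibre H ` {y \<in> H. pp y = y \<and> ord y \<le> p ^ j})"
    using self_in_fibre[OF H, of g] pp_in_subgroup[OF H, of g] pp_idem[of g] ord_pp[of g] p_gt_1
    by auto
next
  fix g assume "g \<in> \<Union> (fibre H ` {y \<in> H. pp y = y \<and> ord y \<le> p ^ j})"
  then obtain y where y: "y \<in> H" "pp y = y" "ord y \<le> p ^ j" "g \<in> fibre H y" by auto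
  then have "p ^ multiplicity p (ord g) \<le> p ^ j" using fibre_multiplicity[OF H] by metis
  then show "g \<in> upto_part H j" using y p_gt_1 by (auto simp: upto_part_def fibre_def)
qed

lemma preg_dvd_card_upto_part:
  assumes H: "subgroup H G"
  shows "preg H dvd card (upto_part H j)"
proof -
  have "finite (upto_part H j)" using subgroup_finite[OF H] by (simp add: upto_part_def)
  then show ?thesis
    using preg_dvd_card_fibre[OF H] fibre_disjoint[OF H]
    unfolding upto_part_eq_Union[OF H] by (intro dvd_partition) (simp, blast, blast)
qed

section \<open>Generators of cyclic subgroups and congruences for the counts\<close>

text \<open>The power g^k generates the same group as g iff k is prime to \<open>ord g\<close>.
  Exponents run over \<open>{0<..ord g}\<close> to match the representatives in
  \<open>totatives\<close>.\<close>

lemma card_generators: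
  assumes g: "g \<in> carrier G"
  shows "card {h \<in> carrier G. generate G {h} = generate G {g}} = totient (ord g)"
proof -
  have gsub: "subgroup (generate G {g}) G" using g generate_is_subgroup by blast
  have inj: "inj_on (\<lambda>k::nat. g [^] k) {0<..ord g}"
    using ord_inj'[OF g] by (simp add: atLeastSucAtMost_greaterThanAtMost)
  have pin: "g [^] k \<in> generate G {g}" for k :: nat
    using subgroup_pow_closed[OF gsub] generate.incl[of g "{g}" G] by simp
  have im: "(\<lambda>k::nat. g [^] k) ` {0<..ord g} = generate G {g}"
  proof (rule card_subset_eq)
    show "finite (generate G {g})" using subgroup_finite[OF gsub] .
    show "card ((\<lambda>k::nat. g [^] k) ` {0<..ord g}) = card (generate G {g})"
      using card_image[OF inj] generate_pow_card[OF g] by simp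
  qed (use pin in auto)
  have iff: "generate G {g [^] k} = generate G {g} \<longleftrightarrow> coprime k (ord g)" for k :: nat
  proof
    assume "generate G {g [^] k} = generate G {g}"
    then have "ord (g [^] k) = ord g"
      using generate_pow_card[of "g [^] k"] generate_pow_card[OF g] g by simp
    then show "coprime k (ord g)" using pow_ord_eq_ord_iff[OF finite_carrier g] by blast
  next
    assume "coprime k (ord g)"
    then have "card (generate G {g [^] k}) = card (generate G {g})"
      using pow_ord_eq_ord_iff[OF finite_carrier g, of k] generate_pow_card[of "g [^] k"]
        generate_pow_card[OF g] g by simp
    moreover have "generate G {g [^] k} \<subseteq> generate G {g}"
      using generate_subgroup_incl[OF _ gsub, of "{g [^] k}"] pin by simp
    ultimately show "generate G {g [^] k} = generate G {g}"
      using card_subset_eq[OF subgroup_finite[OF gsub]] by blast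
  qed
  have "{h \<in> carrier G. generate G {h} = generate G {g}} = (\<lambda>k::nat. g [^] k) ` totatives (ord g)"
  proof (intro equalityI subsetI)
    fix h assume h: "h \<in> {h \<in> carrier G. generate G {h} = generate G {g}}"
    then have "h \<in> generate G {g}" using generate.incl[of h "{h}" G] by auto
    then obtain k where k: "k \<in> {0<..ord g}" "h = g [^] k" using im by blast
    then show "h \<in> (\<lambda>k::nat. g [^] k) ` totatives (ord g)"
      using iff[of k] h by (auto simp: totatives_def)
  next
    fix h assume "h \<in> (\<lambda>k::nat. g [^] k) ` totatives (ord g)"
    then show "h \<in> {h \<in> carrier G. generate G {h} = generate G {g}}"
      using iff g by (auto simp: totatives_def)
  qed
  then show ?thesis
    using inj_on_subset[OF inj totatives_subset] by (simp add: card_image totient_def)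
qed

text \<open>Group the elements by the cyclic subgroup they generate: each block has
  \<open>totient (ord g)\<close> elements, and \<open>p ^ Suc j\<close> divides
  \<open>ord g\<close>. The factor p^j serves Frobenius' divisibility, the factor p - 1 the lower
  bound for the defect.\<close>

lemma dvd_card_above_part:
  assumes H: "subgroup H G"
  shows "p ^ j * (p - 1) dvd card (H - upto_part H j)"
proof -
  let ?gen = "\<lambda>g. {h \<in> carrier G. generate G {h} = generate G {g}}"
  note Hc = subgroup.mem_carrier[OF H]
  have "p ^ j * (p - 1) dvd card (?gen g)" if "g \<in> H - upto_part H j" for g
  proof -
    have g: "g \<in> carrier G" "Suc j \<le> multiplicity p (ord g)"
      using that Hc by (auto simp: upto_part_def)
    then have "p ^ Suc j dvd ord g" using multiplicity_dvd' by blast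
    then have "totient (p ^ Suc j) dvd totient (ord g)" by (rule totient_dvd)
    then show ?thesis
      using card_generators[OF g(1)] totient_prime_power_Suc[OF prime_p, of j] by simp
  qed
  moreover have "\<Union> (?gen ` (H - upto_part H j)) = H - upto_part H j"
  proof (intro equalityI subsetI)
    fix h assume "h \<in> \<Union> (?gen ` (H - upto_part H j))"
    then obtain g where g: "g \<in> H" "g \<notin> upto_part H j" "h \<in> carrier G" "generate G {h} = generate G {g}"
      by auto
    have "h \<in> generate G {g}" using g(4) generate.incl[of h "{h}" G] by auto
    then have "h \<in> H" using generate_subgroup_incl[OF _ H, of "{g}"] g by auto
    moreover have "ord h = ord g"
      using generate_pow_card[of h] generate_pow_card[of g] g Hc by simp
    ultimately show "h \<in> H - upto_part H j" using g by (auto simp: upto_part_def)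
  next
    fix h assume "h \<in> H - upto_part H j"
    then show "h \<in> \<Union> (?gen ` (H - upto_part H j))" using Hc by blast
  qed
  moreover have "finite (H - upto_part H j)" using subgroup_finite[OF H] by simp
  ultimately show ?thesis
    using dvd_partition[of "?gen ` (H - upto_part H j)" "p ^ j * (p - 1)"] by fastforce
qed

lemma card_above_part:
  assumes "subgroup H G"
  shows "card H = card (upto_part H j) + card (H - upto_part H j)"
proof -
  have "upto_part H j \<subseteq> H" by (auto simp: upto_part_def)
  then show ?thesis
    using subgroup_finite[OF assms] card_mono[of H "upto_part H j"]
    by (simp add: card_Diff_subset finite_subset)
qed

text \<open>The factor p^j is read off from the complement, as p^j divides both its size and the
  group order; the factor \<open>preg H\<close> comes from the p-sections, and the two are
  coprime.\<close>

lemma dvd_card_upto_part: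
  assumes H: "subgroup H G" and j: "j \<le> multiplicity p (card H)"
  shows "p ^ j * preg H dvd card (upto_part H j)"
proof (rule divides_mult)
  have "p ^ j dvd card H" using j multiplicity_dvd' by blast
  moreover have "p ^ j dvd card (H - upto_part H j)"
    using dvd_card_above_part[OF H, of j] by (rule dvd_mult_left)
  ultimately show "p ^ j dvd card (upto_part H j)"
    using card_above_part[OF H, of j] by (metis dvd_add_left_iff)
  show "preg H dvd card (upto_part H j)" by (rule preg_dvd_card_upto_part[OF H])
  show "coprime (p ^ j) (preg H)" by (rule coprime_p_power[OF preg_not_dvd[OF H]])
qed

lemma card_upto_part_ge:
  assumes H: "subgroup H G" and j: "j \<le> multiplicity p (card H)"
  shows "p ^ j * preg H \<le> card (upto_part H j)"
proof (rule dvd_imp_le[OF dvd_card_upto_part[OF assms]])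
  show "card (upto_part H j) > 0"
    using one_in_upto_part[OF H] subgroup_finite[OF H] by (auto simp: upto_part_def card_gt_0_iff)
qed


subsection \<open>Weights and the defect\<close>

text \<open>
  The weight is the solution of the equations that its sum over every cyclic group of order n is
  n times the p-adic valuation of n.
\<close>
definition wt :: "'a \<Rightarrow> rat" where
  "wt g = of_nat (multiplicity p (ord g)) + (if p dvd ord g then 1 / (of_nat p - 1) else 0)"

text \<open>For the whole group this turns out to be -|G| times the valuation. It is defined for
  every subgroup because its vanishing on cyclic subgroups is what makes the weight work.\<close>

definition defect :: "'a set \<Rightarrow> rat" where
  "defect H = (\<Sum>j<multiplicity p (card H). of_nat (card (upto_part H j)) - of_nat (p ^ j * preg H))
     + (of_nat (card (upto_part H 0)) - of_nat (preg H)) / (of_nat p - 1)"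

lemma multiplicity_ord_le:
  "subgroup H G \<Longrightarrow> g \<in> H \<Longrightarrow> multiplicity p (ord g) \<le> multiplicity p (card H)"
  using ord_dvd_card[of H g] card_subgroup_pos[of H] by (intro dvd_imp_multiplicity_le) auto

text \<open>The valuation of \<open>ord g\<close> is the number of j below it; exchanging the sums
  turns its total into the sizes of the complements of \<open>upto_part H j\<close>. The second part
  of the weight contributes the number of p-singular elements divided by p - 1.\<close>

lemma sum_wt:
  assumes H: "subgroup H G"
  shows "(\<Sum>g\<in>H. wt g) = of_nat (card H) * of_nat (multiplicity p (card H)) - defect H"
proof -
  define a where "a = multiplicity p (card H)"
  define q where "q = (of_nat p :: rat)"
  define N where "N j = (of_nat (card (upto_part H j)) :: rat)" for j
  define P where "P = (of_nat (preg H) :: rat)"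
  have q1: "q \<noteq> 1" using p_gt_1 by (simp add: q_def)
  have finH: "finite H" using subgroup_finite[OF H] .
  have cH: "of_nat (card H) = q ^ a * P"
    using card_split[of H] by (simp add: q_def P_def ppart_def a_def flip: of_nat_power of_nat_mult)
  have N: "of_nat (card (H - upto_part H j)) = q ^ a * P - N j" for j
    using card_above_part[OF H, of j] by (simp add: N_def flip: cH)
  have "(\<Sum>g\<in>H. of_nat (multiplicity p (ord g)) :: rat)
      = (\<Sum>g\<in>H. \<Sum>j<a. if j < multiplicity p (ord g) then 1 else 0)"
  proof (rule sum.cong)
    fix g assume "g \<in> H"
    then have "multiplicity p (ord g) \<le> a" using multiplicity_ord_le[OF H] by (simp add: a_def)
    then have "{..<a} \<inter> {j. j < multiplicity p (ord g)} = {..<multiplicity p (ord g)}" by auto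
    then show "(of_nat (multiplicity p (ord g)) :: rat)
        = (\<Sum>j<a. if j < multiplicity p (ord g) then 1 else 0)"
      by (simp add: sum.If_cases)
  qed simp
  also have "\<dots> = (\<Sum>j<a. \<Sum>g\<in>H. if j < multiplicity p (ord g) then 1 else 0)"
    by (rule sum.swap)
  also have "\<dots> = (\<Sum>j<a. of_nat (card (H - upto_part H j)))"
  proof (rule sum.cong)
    fix j
    have "H \<inter> {g. j < multiplicity p (ord g)} = H - upto_part H j" by (auto simp: upto_part_def)
    then show "(\<Sum>g\<in>H. if j < multiplicity p (ord g) then 1 else 0)
        = (of_nat (card (H - upto_part H j)) :: rat)"
      using finH by (simp add: sum.If_cases)
  qed simp
  finally have 1: "(\<Sum>g\<in>H. of_nat (multiplicity p (ord g)) :: rat) = (\<Sum>j<a. q ^ a * P - N j)"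
    by (simp add: N)
  have "p dvd ord g \<longleftrightarrow> g \<notin> upto_part H 0" if "g \<in> H" for g
    using upto_part_0[OF H] pp_eq_one_iff[of g] subgroup.mem_carrier[OF H that] that
    by (simp add: reg_def)
  then have "H \<inter> {g. p dvd ord g} = H - upto_part H 0" by auto
  then have 2: "(\<Sum>g\<in>H. if p dvd ord g then 1 / (q - 1) else 0) = (q ^ a * P - N 0) / (q - 1)"
    using finH by (simp add: sum.If_cases N)
  have "(\<Sum>g\<in>H. wt g) = (\<Sum>j<a. q ^ a * P - N j) + (q ^ a * P - N 0) / (q - 1)"
    by (simp only: wt_def sum.distrib 1 2 flip: q_def)
  also have "\<dots> = q ^ a * P * of_nat a - (\<Sum>j<a. N j) + (q ^ a * P - N 0) / (q - 1)"
    by (simp add: sum_subtractf)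
  finally have 3: "(\<Sum>g\<in>H. wt g) = q ^ a * P * of_nat a - (\<Sum>j<a. N j) + (q ^ a * P - N 0) / (q - 1)" .
  \<comment> \<open>The right-hand side is (|H| - P) / (q - 1): this identity is how the numbers p^j
    \<open>preg H\<close> enter the defect.\<close>
  have "(\<Sum>j<a. q ^ j * P) = (q ^ a - 1) / (q - 1) * P"
    using geometric_sum[OF q1, of a] by (simp flip: sum_distrib_right)
  then have "defect H = (\<Sum>j<a. N j) - (q ^ a - 1) / (q - 1) * P + (N 0 - P) / (q - 1)"
    unfolding defect_def a_def[symmetric] by (simp add: sum_subtractf N_def P_def q_def)
  moreover have "(q ^ a * P - N 0) / (q - 1) = (q ^ a - 1) / (q - 1) * P - (N 0 - P) / (q - 1)"
    unfolding times_divide_eq_left diff_divide_distrib[symmetric] by (simp add: left_diff_distrib)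
  ultimately show ?thesis using 3 cH by (simp add: a_def)
qed

lemma preg_eq_card: "multiplicity p (card H) = 0 \<Longrightarrow> preg H = card H"
  by (metis card_split mult_1 power_0 ppart_def)

text \<open>Modulo p - 1 the group order is congruent to \<open>preg H\<close>, and the number of
  p-singular elements is 0.\<close>

lemma card_upto_part_0_diff:
  assumes H: "subgroup H G"
  shows "p - 1 dvd card (upto_part H 0) - preg H"
proof -
  define a where "a = multiplicity p (card H)"
  have c: "card H = p ^ a * preg H" unfolding a_def using card_split[of H] by (simp only: ppart_def)
  have "p - 1 dvd card (H - upto_part H 0)"
    using dvd_card_above_part[OF H, of 0] by simp
  \<comment> \<open>The factorisation of x^a - 1 is taken over the integers, where subtraction is
    not truncated.\<close>
  moreover have "int p - 1 dvd int p ^ a - 1"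
    by (simp add: power_diff_1_eq)
  then have "int (p - 1) dvd int (p ^ a - 1)" using p_gt_1 by (simp add: of_nat_diff)
  then have "p - 1 dvd p ^ a - 1" by (simp only: int_dvd_int_iff)
  then have "p - 1 dvd (p ^ a - 1) * preg H" by simp
  moreover have "(p ^ a - 1) * preg H
      = (card (upto_part H 0) - preg H) + card (H - upto_part H 0)"
    using c card_above_part[OF H, of 0] card_upto_part_ge[OF H, of 0]
    by (simp add: diff_mult_distrib)
  ultimately show ?thesis by (metis dvd_add_left_iff)
qed

lemma defect_nonneg_terms:
  assumes H: "subgroup H G"
  shows "j \<le> multiplicity p (card H) \<Longrightarrow>
      (of_nat (card (upto_part H j)) :: rat) - of_nat (p ^ j * preg H) \<ge> 0"
    and "(of_nat (card (upto_part H 0)) - of_nat (preg H)) / (of_nat p - 1) \<ge> (0 :: rat)"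
proof -
  show 1: "(of_nat (card (upto_part H j)) :: rat) - of_nat (p ^ j * preg H) \<ge> 0"
    if "j \<le> multiplicity p (card H)" for j
    using card_upto_part_ge[OF H that] by (simp flip: of_nat_mult of_nat_power)
  show "(of_nat (card (upto_part H 0)) - of_nat (preg H)) / (of_nat p - 1) \<ge> (0 :: rat)"
    using 1[of 0] p_gt_1 by simp
qed

lemma defect_eq_0_iff:
  assumes H: "subgroup H G"
  shows "defect H = 0 \<longleftrightarrow> (\<forall>j<multiplicity p (card H). card (upto_part H j) = p ^ j * preg H)"
proof
  assume "defect H = 0"
  moreover have "(\<Sum>j<multiplicity p (card H). of_nat (card (upto_part H j)) - of_nat (p ^ j * preg H)) \<ge> (0::rat)"
    using defect_nonneg_terms(1)[OF H] by (intro sum_nonneg) auto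
  ultimately have "(\<Sum>j<multiplicity p (card H). of_nat (card (upto_part H j)) - of_nat (p ^ j * preg H)) = (0::rat)"
    using defect_nonneg_terms(2)[OF H] unfolding defect_def by linarith
  then have "\<forall>j\<in>{..<multiplicity p (card H)}. of_nat (card (upto_part H j)) - of_nat (p ^ j * preg H) = (0::rat)"
    using defect_nonneg_terms(1)[OF H] by (subst (asm) sum_nonneg_eq_0_iff) auto
  then show "\<forall>j<multiplicity p (card H). card (upto_part H j) = p ^ j * preg H"
    by (metis eq_iff_diff_eq_0 lessThan_iff of_nat_eq_iff)
next
  assume *: "\<forall>j<multiplicity p (card H). card (upto_part H j) = p ^ j * preg H"
  have "card (upto_part H 0) = preg H"
  \<comment> \<open>If p does not divide the order, the hypothesis is void, but then
    \<open>preg H\<close> is the full order and the lower bound for \<open>upto_part H 0\<close> is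
    already attained.\<close>
  proof (cases "multiplicity p (card H) = 0")
    case True
    then show ?thesis
      using preg_eq_card[of H] card_upto_part_ge[OF H, of 0] card_above_part[OF H, of 0] by simp
  qed (use * in auto)
  then show "defect H = 0" using * by (simp add: defect_def)
qed

text \<open>A nonzero term with j > 0 is a positive multiple of p. For j = 0 it is only known to be
  at least p - 1, but it occurs a second time divided by p - 1 and so adds at least 1 more: this is
  where the constant p comes from.\<close>

lemma defect_ge_p:
  assumes H: "subgroup H G" and "defect H \<noteq> 0"
  shows "defect H \<ge> of_nat p"
proof -
  let ?a = "multiplicity p (card H)"
  let ?t = "\<lambda>j. (of_nat (card (upto_part H j)) :: rat) - of_nat (p ^ j * preg H)"
  have ge: "\<And>j. j \<le> ?a \<Longrightarrow> p ^ j * preg H \<le> card (upto_part H j)"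
    using card_upto_part_ge[OF H] by blast
  obtain j where j: "j < ?a" "card (upto_part H j) \<noteq> p ^ j * preg H"
    using assms defect_eq_0_iff[OF H] by blast
  then have pos: "card (upto_part H j) - p ^ j * preg H > 0" using ge[of j] by simp
  have t: "?t j = of_nat (card (upto_part H j) - p ^ j * preg H)"
    using ge[of j] j by (simp add: of_nat_diff)
  have le: "?t j \<le> (\<Sum>j<?a. ?t j)"
    using j defect_nonneg_terms(1)[OF H] by (intro member_le_sum) auto
  show ?thesis
  proof (cases "j = 0")
    case False
    have "p dvd p ^ j" using False by simp
    then have "p dvd card (upto_part H j) - p ^ j * preg H"
      using dvd_card_upto_part[OF H, of j] j
      by (metis dvd_diff_nat dvd_mult_left dvd_trans dvd_triv_left less_imp_le)
    then have "p \<le> card (upto_part H j) - p ^ j * preg H" using pos dvd_imp_le by blast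
    then have "of_nat p \<le> ?t j" unfolding t by simp
    then show ?thesis using le defect_nonneg_terms(2)[OF H] unfolding defect_def by linarith
  next
    case True
    have "p - 1 \<le> card (upto_part H 0) - preg H"
      using card_upto_part_0_diff[OF H] pos True by (intro dvd_imp_le) auto
    then have *: "of_nat p - 1 \<le> ?t 0"
      using t True p_gt_1 by (metis (no_types, lifting) mult_1 of_nat_1 of_nat_diff of_nat_le_iff less_imp_le power_0)
    then have "1 \<le> ?t 0 / (of_nat p - 1)" using p_gt_1 by simp
    then show ?thesis using le * True unfolding defect_def by simp
  qed
qed

text \<open>All these elements lie in the subgroup of order p^j generated by
  \<open>x [^] (p ^ (a - j))\<close>. Combined with \<open>card_seteq\<close>, the bound expresses
  that a cyclic p-group has only one subgroup of each order.\<close>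

lemma card_upto_part_cyclic_le:
  assumes x: "x \<in> carrier G" "ord x = p ^ a" and j: "j \<le> a"
  shows "card {y \<in> generate G {x}. ord y \<le> p ^ j} \<le> p ^ j"
proof -
  let ?z = "x [^] (p ^ (a - j))"
  have pp0: "p ^ k \<noteq> 0" for k using p_gt_1 by simp
  have aj: "p ^ a = p ^ (a - j) * p ^ j" using j by (simp flip: power_add)
  have oz: "ord ?z = p ^ j"
    using ord_pow[of x "p ^ (a - j)"] x pp0[of "a - j"] aj by simp
  have zsub: "subgroup (generate G {?z}) G" using x by (intro generate_is_subgroup) auto
  have "{y \<in> generate G {x}. ord y \<le> p ^ j} \<subseteq> generate G {?z}"
  proof
    fix y assume "y \<in> {y \<in> generate G {x}. ord y \<le> p ^ j}"
    then have y: "y \<in> generate G {x}" "ord y \<le> p ^ j" by auto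
    then obtain k :: nat where k: "y = x [^] k"
      using generate_pow_on_finite_carrier[OF finite_carrier x(1)] by auto
    have yc: "y \<in> carrier G" using k x by simp
    have "ord y dvd p ^ a"
      using ord_dvd_card[OF generate_is_subgroup y(1)] x generate_pow_card[OF x(1)] by simp
    then obtain i where i: "ord y = p ^ i" using divides_primepow_nat[OF prime_p] by blast
    then have "i \<le> j" using y(2) p_gt_1 by simp
    then have "ord y dvd p ^ j" using i by (simp add: le_imp_power_dvd)
    then have "y [^] (p ^ j) = \<one>" using pow_eq_id[OF yc] by blast
    then have "p ^ a dvd k * p ^ j" using x k by (simp add: nat_pow_pow pow_eq_id)
    then have "p ^ (a - j) dvd k" unfolding aj using p_gt_1 by simp
    then obtain l where "k = p ^ (a - j) * l" by blast
    then have "y = ?z [^] l" using k x by (simp add: nat_pow_pow)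
    then show "y \<in> generate G {?z}"
      using subgroup_pow_closed[OF zsub] generate.incl[of ?z "{?z}" G] by simp
  qed
  then have "card {y \<in> generate G {x}. ord y \<le> p ^ j} \<le> card (generate G {?z})"
    using subgroup_finite[OF zsub] by (rule card_mono[rotated])
  then show ?thesis using generate_pow_card[of ?z] oz x by simp
qed

lemma prime_power_ord_in_generate:
  assumes "x \<in> carrier G" "ord x = p ^ a" "y \<in> generate G {x}"
  shows "y \<in> carrier G" "pp y = y"
proof -
  have sub: "subgroup (generate G {x}) G" using assms by (intro generate_is_subgroup) auto
  show yc: "y \<in> carrier G" using subgroup.mem_carrier[OF sub] assms by blast
  have "ord y dvd p ^ a" using ord_dvd_card[OF sub] assms generate_pow_card[of x] by simp
  then show "pp y = y" using divides_primepow_nat[OF prime_p] pp_eq_self[OF yc] by blast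
qed

text \<open>
  The elements whose p-part is conjugate to a given p-element form a nonempty set of size
  divisible by the p'-part of the order. If the elements of a cyclic Sylow subgroup are pairwise
  nonconjugate, these sets already fill up the complement of \<open>upto_part H j\<close>.
\<close>
lemma card_upto_part_eq:
  assumes H: "subgroup H G" and x: "x \<in> H" "ord x = ppart H"
    and nonconj: "\<And>u v. u \<in> generate G {x} \<Longrightarrow> v \<in> generate G {x} \<Longrightarrow> v \<in> cls H u \<Longrightarrow> u = v"
    and j: "j \<le> multiplicity p (card H)"
  shows "card (upto_part H j) = p ^ j * preg H"
proof -
  note Hc = subgroup.mem_carrier[OF H]
  let ?a = "multiplicity p (card H)"
  let ?X = "generate G {x}"
  let ?W = "{y \<in> ?X. p ^ j < ord y}"
  have xc: "x \<in> carrier G" and ox: "ord x = p ^ ?a" using x Hc by (auto simp: ppart_def)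
  have Xsub: "subgroup ?X G" using xc by (intro generate_is_subgroup) auto
  have XH: "?X \<subseteq> H" using generate_subgroup_incl[OF _ H, of "{x}"] x by simp
  have finX: "finite ?X" using subgroup_finite[OF Xsub] .
  have finH: "finite H" using subgroup_finite[OF H] .
  have "card ?X = card ?W + card {y \<in> ?X. ord y \<le> p ^ j}"
  proof -
    have "?X = ?W \<union> {y \<in> ?X. ord y \<le> p ^ j}" by auto
    moreover have "?W \<inter> {y \<in> ?X. ord y \<le> p ^ j} = {}" by auto
    ultimately show ?thesis using finX card_Un_disjoint[of ?W "{y \<in> ?X. ord y \<le> p ^ j}"] by simp
  qed
  then have cW: "p ^ ?a \<le> card ?W + p ^ j"
    using card_upto_part_cyclic_le[OF xc ox j] generate_pow_card[OF xc] ox by simp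
  have fib: "preg H \<le> card (fibre H y)" if "y \<in> ?W" for y
  proof (rule dvd_imp_le)
    have y: "y \<in> H" "pp y = y"
      using that XH prime_power_ord_in_generate[OF xc ox] by auto
    show "preg H dvd card (fibre H y)" using preg_dvd_card_fibre[OF H y] .
    have "y \<in> fibre H y" using self_in_fibre[OF H y(1)] y(2) by simp
    then show "0 < card (fibre H y)" using finH by (auto simp: card_gt_0_iff fibre_def)
  qed
  have disj: "fibre H y \<inter> fibre H z = {}" if yz: "y \<in> ?W" "z \<in> ?W" "y \<noteq> z" for y z
  proof (rule ccontr)
    assume "fibre H y \<inter> fibre H z \<noteq> {}"
    then have "fibre H y = fibre H z" using fibre_disjoint[OF H] yz XH by blast
    then have "z \<in> fibre H y"
      using self_in_fibre[OF H, of z] yz XH prime_power_ord_in_generate[OF xc ox, of z] by auto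
    then have "z \<in> cls H y"
      using prime_power_ord_in_generate[OF xc ox, of z] yz by (simp add: fibre_def)
    then show False using nonconj yz by auto
  qed
  have "card (\<Union>y\<in>?W. fibre H y) = (\<Sum>y\<in>?W. card (fibre H y))"
    using finX finH disj by (intro card_UN_disjoint) (auto simp: fibre_def)
  then have "card ?W * preg H \<le> card (\<Union>y\<in>?W. fibre H y)"
    using sum_mono[of ?W "\<lambda>_. preg H" "\<lambda>y. card (fibre H y)"] fib by simp
  also have "\<dots> \<le> card (H - upto_part H j)"
  proof (rule card_mono)
    show "(\<Union>y\<in>?W. fibre H y) \<subseteq> H - upto_part H j"
    proof
      fix g assume "g \<in> (\<Union>y\<in>?W. fibre H y)"
      then obtain y where y: "y \<in> ?X" "p ^ j < ord y" "g \<in> fibre H y" by auto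
      have "p ^ j < p ^ multiplicity p (ord g)"
        using fibre_multiplicity[OF H _ _ y(3)] y XH prime_power_ord_in_generate[OF xc ox y(1)] by auto
      then have "j < multiplicity p (ord g)" using p_gt_1 by simp
      then show "g \<in> H - upto_part H j" using y by (auto simp: fibre_def upto_part_def)
    qed
  qed (use finH in simp)
  finally have "card ?W * preg H \<le> card (H - upto_part H j)" .
  moreover have "p ^ ?a * preg H \<le> (card ?W + p ^ j) * preg H" using cW by (rule mult_le_mono1)
  \<comment> \<open>The sections of the at least p^a - p^j elements of \<open>?W\<close> are
    disjoint and take away at least (p^a - p^j) \<open>preg H\<close> elements. The opposite
    inequality is Frobenius' bound.\<close>
  ultimately have "card (upto_part H j) \<le> p ^ j * preg H"
    using card_above_part[OF H, of j] card_split[of H, unfolded ppart_def]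
    unfolding add_mult_distrib by linarith
  then show ?thesis using card_upto_part_ge[OF H j] by simp
qed

text \<open>Conjugate elements of an abelian group coincide, and \<open>pp g\<close> generates the
  Sylow p-subgroup of <g>, so the preceding count gives defect zero.\<close>

lemma sum_wt_cyclic:
  assumes g: "g \<in> carrier G"
  shows "(\<Sum>h\<in>generate G {g}. wt h)
    = of_nat (card (generate G {g})) * of_nat (multiplicity p (card (generate G {g})))"
proof -
  let ?H = "generate G {g}"
  have H: "subgroup ?H G" using g by (intro generate_is_subgroup) auto
  have comm: "u \<otimes> v = v \<otimes> u" if "u \<in> ?H" "v \<in> ?H" for u v
    using that generate_pow_on_finite_carrier[OF finite_carrier g] nat_pow_comm[OF g] by auto
  have x: "pp g \<in> ?H" "ord (pp g) = ppart ?H"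
    using pp_in_subgroup[OF H] generate.incl[of g "{g}" G] ord_pp[OF g] generate_pow_card[OF g]
    by (auto simp: ppart_def)
  have sub: "generate G {pp g} \<subseteq> ?H" using generate_subgroup_incl[OF _ H, of "{pp g}"] x by simp
  have "u = v" if "u \<in> generate G {pp g}" "v \<in> generate G {pp g}" "v \<in> cls ?H u" for u v
  proof -
    obtain h where "h \<in> ?H" "v = h \<otimes> u \<otimes> inv h" using \<open>v \<in> cls ?H u\<close> by (auto simp: cls_def)
    then show ?thesis
      using comm[of h u] that sub subgroup.mem_carrier[OF H] by (metis conj_eq_iff in_mono)
  qed
  then have "defect ?H = 0"
    using card_upto_part_eq[OF H x] defect_eq_0_iff[OF H] by simp
  then show ?thesis using sum_wt[OF H] by simp
qed


subsection \<open>Groups whose p-hypo-elementary subgroups are cyclic\<close>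

lemma generate_cases_nat:
  assumes "x \<in> carrier G" "y \<in> generate G {x}"
  obtains k :: nat where "y = x [^] k"
  using generate_pow_on_finite_carrier[OF finite_carrier assms(1)] assms(2) by auto

lemma generate_subgroup1: "x \<in> carrier G \<Longrightarrow> subgroup (generate G {x}) G"
  by (intro generate_is_subgroup) auto

lemma self_in_generate: "x \<in> generate G {x}"
  by (rule generate.incl) simp

lemma pow_in_generate: "x \<in> carrier G \<Longrightarrow> x [^] (k::nat) \<in> generate G {x}"
  using subgroup_pow_closed[OF generate_subgroup1] self_in_generate by blast

lemma generate_commute:
  assumes "x \<in> carrier G" "u \<in> generate G {x}" "v \<in> generate G {x}"
  shows "u \<otimes> v = v \<otimes> u"
proof -
  obtain i j :: nat where "u = x [^] i" "v = x [^] j" using assms generate_cases_nat by metis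
  then show ?thesis using nat_pow_comm[OF assms(1)] by simp
qed

lemma cyclic_subgroup_iff:
  assumes K: "subgroup K G"
  shows "cyclic_group (G\<lparr>carrier := K\<rparr>) \<longleftrightarrow> (\<exists>g\<in>K. K = generate G {g})"
proof -
  interpret K: group "G\<lparr>carrier := K\<rparr>"
    using K subgroup.subgroup_is_group is_group by blast
  have "range (\<lambda>n::int. x [^]\<^bsub>G\<lparr>carrier := K\<rparr>\<^esub> n) = generate G {x}" if "x \<in> K" for x
  proof -
    have "(\<lambda>n::int. x [^]\<^bsub>G\<lparr>carrier := K\<rparr>\<^esub> n) = (\<lambda>n::int. x [^] n)"
      using int_pow_consistent[OF K that] by auto
    then show ?thesis using generate_pow[of x] subgroup.mem_carrier[OF K that] by auto
  qed
  then show ?thesis using K.cyclic_group by auto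
qed

section \<open>Double cosets and conjugacy into Sylow subgroups\<close>

text \<open>The last set is the intersection of A with h B h^-1. For h = 1 this is the product
  formula for |A B|, which is also used below.\<close>

lemma card_double_coset:
  assumes A: "subgroup A G" and B: "subgroup B G" and h: "h \<in> carrier G"
  shows "card A * card B
    = card ((\<lambda>(a, b). a \<otimes> h \<otimes> b) ` (A \<times> B)) * card {s \<in> A. inv h \<otimes> s \<otimes> h \<in> B}"
proof -
  note Ac = subgroup.mem_carrier[OF A]
  note Bc = subgroup.mem_carrier[OF B]
  define f where "f = (\<lambda>(a, b). a \<otimes> h \<otimes> b)"
  define S where "S = {s \<in> A. inv h \<otimes> s \<otimes> h \<in> B}"
  have "card {z \<in> A \<times> B. f z = c} = card S" if c: "c \<in> f ` (A \<times> B)" for c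
  proof -
    obtain a b where ab: "a \<in> A" "b \<in> B" "c = a \<otimes> h \<otimes> b" using c by (auto simp: f_def)
    \<comment> \<open>An element \<open>s\<close> of A and its conjugate in B cancel across
      \<open>h\<close>: (a s) h (h^-1 s h)^-1 b = a h b. All pairs with the same product arise in
      this way.\<close>
    define \<phi> where "\<phi> = (\<lambda>s. (a \<otimes> s, inv (inv h \<otimes> s \<otimes> h) \<otimes> b))"
    have "{z \<in> A \<times> B. f z = c} = \<phi> ` S"
    proof (intro equalityI subsetI)
      fix z assume "z \<in> {z \<in> A \<times> B. f z = c}"
      then obtain u v where uv: "z = (u, v)" "u \<in> A" "v \<in> B" "u \<otimes> h \<otimes> v = a \<otimes> h \<otimes> b"
        using ab by (auto simp: f_def)
      note cc = Ac[OF uv(2)] Bc[OF uv(3)] Ac[OF ab(1)] Bc[OF ab(2)] h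
      define s where "s = inv a \<otimes> u"
      have sc: "s \<in> carrier G" using cc by (simp add: s_def)
      have us: "u = a \<otimes> s" using cc by (simp add: s_def flip: m_assoc)
      have "a \<otimes> (s \<otimes> (h \<otimes> v)) = a \<otimes> (h \<otimes> b)" using uv(4) us cc sc by (simp add: m_assoc)
      then have sv: "s \<otimes> (h \<otimes> v) = h \<otimes> b" using cc sc by simp
      have sA: "s \<in> A" using uv ab A by (simp add: s_def subgroup.m_closed subgroup.m_inv_closed)
      have "inv h \<otimes> s \<otimes> h \<otimes> v = b"
        using sv cc sc by (simp add: m_assoc) (simp flip: m_assoc)
      then have v: "inv h \<otimes> s \<otimes> h = b \<otimes> inv v" and v': "v = inv (inv h \<otimes> s \<otimes> h) \<otimes> b"
        using cc sc by (metis inv_closed inv_solve_right m_closed, metis inv_solve_left m_closed inv_closed)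
      have "s \<in> S" using sA v uv ab B by (simp add: S_def subgroup.m_closed subgroup.m_inv_closed)
      then show "z \<in> \<phi> ` S" using uv(1) us v' by (auto simp: \<phi>_def)
    next
      fix z assume "z \<in> \<phi> ` S"
      then obtain s where s: "s \<in> A" "inv h \<otimes> s \<otimes> h \<in> B" "z = (a \<otimes> s, inv (inv h \<otimes> s \<otimes> h) \<otimes> b)"
        by (auto simp: \<phi>_def S_def)
      note cc = Ac[OF s(1)] Ac[OF ab(1)] Bc[OF ab(2)] h
      have "h \<otimes> (inv h \<otimes> inv s \<otimes> h) = inv s \<otimes> h" using cc by (simp flip: m_assoc)
      then have "s \<otimes> h \<otimes> (inv h \<otimes> inv s \<otimes> h) = h"
        using cc by (simp add: m_assoc) (simp flip: m_assoc)
      moreover have "inv (inv h \<otimes> s \<otimes> h) = inv h \<otimes> inv s \<otimes> h"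
        using cc by (simp add: inv_mult_group m_assoc)
      ultimately have "a \<otimes> s \<otimes> h \<otimes> (inv (inv h \<otimes> s \<otimes> h) \<otimes> b) = a \<otimes> h \<otimes> b"
        using cc by (metis inv_closed m_assoc m_closed)
      then show "z \<in> {z \<in> A \<times> B. f z = c}"
        using s ab A B by (auto simp: f_def subgroup.m_closed subgroup.m_inv_closed)
    qed
    moreover have "inj_on \<phi> S" using Ac ab by (auto simp: inj_on_def \<phi>_def S_def)
    ultimately show ?thesis by (simp add: card_image)
  qed
  then have "card (A \<times> B) = card (f ` (A \<times> B)) * card S"
    using subgroup_finite[OF A] subgroup_finite[OF B] by (intro card_mult_fibres) auto
  then show ?thesis by (simp add: f_def S_def card_cartesian_product)
qed

lemma conj_stabiliser_subgroup:
  assumes A: "subgroup A G" and B: "subgroup B G" and h: "h \<in> carrier G"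
  shows "subgroup {s \<in> A. inv h \<otimes> s \<otimes> h \<in> B} G"
proof (rule subgroupI)
  note Ac = subgroup.mem_carrier[OF A]
  show "{s \<in> A. inv h \<otimes> s \<otimes> h \<in> B} \<subseteq> carrier G" using Ac by auto
  have "\<one> \<in> {s \<in> A. inv h \<otimes> s \<otimes> h \<in> B}"
    using h subgroup.one_closed[OF A] subgroup.one_closed[OF B] by simp
  then show "{s \<in> A. inv h \<otimes> s \<otimes> h \<in> B} \<noteq> {}" by blast
  fix a assume a: "a \<in> {s \<in> A. inv h \<otimes> s \<otimes> h \<in> B}"
  have "inv h \<otimes> inv a \<otimes> h = inv (inv h \<otimes> a \<otimes> h)"
    using a h Ac by (simp add: inv_mult_group m_assoc)
  then show "inv a \<in> {s \<in> A. inv h \<otimes> s \<otimes> h \<in> B}"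
    using a A B by (simp add: subgroup.m_inv_closed)
  fix b assume b: "b \<in> {s \<in> A. inv h \<otimes> s \<otimes> h \<in> B}"
  have "b \<otimes> h = h \<otimes> (inv h \<otimes> (b \<otimes> h))" using b h Ac by (simp flip: m_assoc)
  then have "inv h \<otimes> (a \<otimes> b) \<otimes> h = (inv h \<otimes> a \<otimes> h) \<otimes> (inv h \<otimes> b \<otimes> h)"
    using a b h Ac by (simp add: m_assoc)
  then show "a \<otimes> b \<in> {s \<in> A. inv h \<otimes> s \<otimes> h \<in> B}"
    using a b A B by (simp add: subgroup.m_closed)
qed

lemma card_subgroup_dvd:
  assumes "subgroup A G" "subgroup B G" "A \<subseteq> B"
  shows "card A dvd card B"
proof -
  interpret B: group "G\<lparr>carrier := B\<rparr>"
    using assms(2) subgroup.subgroup_is_group is_group by blast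
  have "subgroup A (G\<lparr>carrier := B\<rparr>)" using assms subgroup_incl by blast
  then show ?thesis using B.lagrange[of A] by (simp add: order_def) (metis dvd_triv_right)
qed

text \<open>Otherwise, for every h in H, the subgroup of U that h^-1 conjugates into P is proper, so
  each double coset U h P has size divisible by p^(a+1), where p^a = |P|. The double cosets
  partition H, so p^(a+1) would divide |H|.\<close>

lemma p_subgroup_conj_into_sylow:
  assumes H: "subgroup H G" and P: "subgroup P G" "P \<subseteq> H" "card P = ppart H"
    and U: "subgroup U G" "U \<subseteq> H" "card U = p ^ b"
  obtains h where "h \<in> H" "\<And>u. u \<in> U \<Longrightarrow> h \<otimes> u \<otimes> inv h \<in> P"
proof -
  note Hc = subgroup.mem_carrier[OF H]
  define D where "D h = (\<lambda>(a, b). a \<otimes> h \<otimes> b) ` (U \<times> P)" for h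
  define a where "a = multiplicity p (card H)"
  have cP: "card P = p ^ a" using P(3) by (simp add: ppart_def a_def)
  have finH: "finite H" using subgroup_finite[OF H] .
  have D_self: "h \<in> D h" if "h \<in> H" for h
    unfolding D_def using that Hc subgroup.one_closed[OF P(1)] subgroup.one_closed[OF U(1)]
    by (intro image_eqI[of _ _ "(\<one>, \<one>)"]) auto
  have D_sub: "D h \<subseteq> H" if "h \<in> H" for h
    using that H P(2) U(2) by (auto simp: D_def subset_iff intro!: subgroup.m_closed)
  have D_trans: "D k \<subseteq> D h" if h: "h \<in> H" and k: "k \<in> D h" for h k
  proof
    fix z assume "z \<in> D k"
    then obtain u v where uv: "u \<in> U" "v \<in> P" "z = u \<otimes> k \<otimes> v" by (auto simp: D_def)
    obtain u' v' where uv': "u' \<in> U" "v' \<in> P" "k = u' \<otimes> h \<otimes> v'" using k by (auto simp: D_def)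
    have "z = (u \<otimes> u') \<otimes> h \<otimes> (v' \<otimes> v)"
      using uv uv' h Hc P(2) U(2) by (simp add: m_assoc subset_iff)
    then show "z \<in> D h"
      using uv uv' P(1) U(1) unfolding D_def
      by (intro image_eqI[of _ _ "(u \<otimes> u', v' \<otimes> v)"]) (auto simp: subgroup.m_closed)
  qed
  have D_sym: "h \<in> D k" if h: "h \<in> H" and k: "k \<in> D h" for h k
  proof -
    obtain u v where uv: "u \<in> U" "v \<in> P" "k = u \<otimes> h \<otimes> v" using k by (auto simp: D_def)
    have cc: "u \<in> carrier G" "v \<in> carrier G" "h \<in> carrier G" using uv h Hc P(2) U(2) by auto
    have "inv u \<otimes> k \<otimes> inv v = inv u \<otimes> (u \<otimes> h) \<otimes> (v \<otimes> inv v)"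
      using uv(3) cc by (simp add: m_assoc)
    then have "h = inv u \<otimes> k \<otimes> inv v" using cc by (simp flip: m_assoc)
    then show ?thesis unfolding D_def
      using uv P(1) U(1) by (intro image_eqI[of _ _ "(inv u, inv v)"]) (auto simp: subgroup.m_inv_closed)
  qed
  have disj: "c1 \<inter> c2 = {}" if c: "c1 \<in> D ` H" "c2 \<in> D ` H" "c1 \<noteq> c2" for c1 c2
  proof (rule ccontr)
    assume "c1 \<inter> c2 \<noteq> {}"
    then obtain g h k where g: "g \<in> D h" "g \<in> D k" "h \<in> H" "k \<in> H" "c1 = D h" "c2 = D k"
      using c by auto
    then have "g \<in> H" using D_sub by blast
    then have "D g = D h" "D g = D k"
      using g D_trans[of h g] D_trans[of g h] D_trans[of k g] D_trans[of g k]
        D_sym[of h g] D_sym[of k g] by blast+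
    then show False using c g by simp
  qed
  have UD: "\<Union> (D ` H) = H" using D_self D_sub by blast
  have "\<exists>h\<in>H. \<forall>u\<in>U. inv h \<otimes> u \<otimes> h \<in> P"
  proof (rule ccontr)
    assume no: "\<not> (\<exists>h\<in>H. \<forall>u\<in>U. inv h \<otimes> u \<otimes> h \<in> P)"
    have "p ^ Suc a dvd card (D h)" if h: "h \<in> H" for h
    proof -
      let ?S = "{s \<in> U. inv h \<otimes> s \<otimes> h \<in> P}"
      have S: "subgroup ?S G" using conj_stabiliser_subgroup[OF U(1) P(1)] h Hc by blast
      have "?S \<subset> U" using no h by blast
      then have "card ?S < p ^ b"
        using psubset_card_mono[OF subgroup_finite[OF U(1)]] U(3) by metis
      moreover have "card ?S dvd p ^ b" using card_subgroup_dvd[OF S U(1)] U(3) by auto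
      then obtain i where i: "card ?S = p ^ i" using divides_primepow_nat[OF prime_p] by blast
      ultimately have "i < b" using p_gt_1 by simp
      have "p ^ b * p ^ a = card (D h) * p ^ i"
        using card_double_coset[OF U(1) P(1), of h] h Hc U(3) cP i by (simp add: D_def)
      moreover have "p ^ b * p ^ a = p ^ (b - i + a) * p ^ i"
        using \<open>i < b\<close> by (simp flip: power_add)
      ultimately have "card (D h) = p ^ (b - i + a)" using p_gt_1 by simp
      then show ?thesis using \<open>i < b\<close> by (simp only:) (intro le_imp_power_dvd, simp)
    qed
    then have "p ^ Suc a dvd card H"
      using dvd_partition[of "D ` H" "p ^ Suc a"] UD finH disj by auto
    then have "Suc a \<le> multiplicity p (card H)"
      using card_subgroup_pos[OF H] p_gt_1 by (intro multiplicity_geI) auto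
    then show False by (simp add: a_def)
  qed
  then obtain h where "h \<in> H" "\<forall>u\<in>U. inv h \<otimes> u \<otimes> h \<in> P" by blast
  then show ?thesis using that[of "inv h"] H Hc by (simp add: subgroup.m_inv_closed)
qed

section \<open>Consequences of cyclicity for normalisers of p-elements\<close>

lemma p_hypo_elementary_p_subgroup:
  assumes P: "subgroup P G" and "card P = p ^ k"
  shows "p_hypo_elementary G p P"
proof -
  interpret P: group "G\<lparr>carrier := P\<rparr>"
    using P subgroup.subgroup_is_group is_group by blast
  have n: "P \<lhd> G\<lparr>carrier := P\<rparr>" using P.normal_self by simp
  interpret nP: normal P "G\<lparr>carrier := P\<rparr>" by (rule n)
  have "carrier (G\<lparr>carrier := P\<rparr> Mod P) = {\<one>\<^bsub>G\<lparr>carrier := P\<rparr> Mod P\<^esub>}"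
    using nP.fact_group_trivial_iff subgroup_finite[OF P] by simp
  then have "cyclic_group (G\<lparr>carrier := P\<rparr> Mod P)"
    using nP.factorgroup_is_group by (intro trivial_imp_cyclic_group) (simp add: trivial_group_def)
  moreover have "card P = p ^ multiplicity p (card P)"
    using assms(2) prime_p by (simp add: prime_elem_multiplicity_power_distrib)
  ultimately show ?thesis
    unfolding p_hypo_elementary_def using P n normal_imp_subgroup by blast
qed

text \<open>Natural exponents suffice, as they exhaust <w> in a finite group; the induction uses
  only that \<open>w\<close> conjugates <y> into itself.\<close>

lemma normalizes_generate:
  assumes y: "y \<in> carrier G" and w: "w \<in> carrier G" and n: "w \<otimes> y \<otimes> inv w \<in> generate G {y}"
    and u: "u \<in> generate G {y}"
  shows "w [^] (k::nat) \<otimes> u \<otimes> inv (w [^] k) \<in> generate G {y}"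
proof (induction k)
  case 0
  then show ?case using u subgroup.mem_carrier[OF generate_subgroup1[OF y]] by simp
next
  case (Suc k)
  let ?z = "w [^] k \<otimes> u \<otimes> inv (w [^] k)"
  have uc: "u \<in> carrier G" using u subgroup.mem_carrier[OF generate_subgroup1[OF y]] by simp
  obtain i :: nat where i: "?z = y [^] i" using Suc.IH generate_cases_nat[OF y] by metis
  have "w \<otimes> ?z \<otimes> inv w = (w \<otimes> y \<otimes> inv w) [^] i" unfolding i using pow_conj[OF w y] by simp
  then have "w \<otimes> ?z \<otimes> inv w \<in> generate G {y}"
    using subgroup_pow_closed[OF generate_subgroup1[OF y] n] by simp
  moreover have "w [^] Suc k = w \<otimes> w [^] k" using w nat_pow_Suc2 by blast
  ultimately show ?case using conj_conj[of w "w [^] k" u] w uc by simp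
qed

text \<open>The product K = <y> <w> is a group because \<open>w\<close> normalises <y>, and it is
  p-hypo-elementary. If \<open>w\<close> is p-regular, <y> is a normal Sylow p-subgroup of K whose
  quotient is an image of <w>; if \<open>w\<close> is a p-element, K is a p-group. So K is cyclic,
  hence abelian. General elements are reduced to these two cases through their p-part and
  p'-part.\<close>

lemma commute_if_hypo_elementary_cyclic:
  assumes hyp: "\<And>K. p_hypo_elementary G p K \<Longrightarrow> cyclic_group (G\<lparr>carrier := K\<rparr>)"
    and y: "y \<in> carrier G" "ord y = p ^ k" and w: "w \<in> carrier G"
    and pw: "ord w = p ^ l \<or> \<not> p dvd ord w"
    and n: "w \<otimes> y \<otimes> inv w \<in> generate G {y}"
  shows "w \<otimes> y = y \<otimes> w"
proof -
  let ?U = "generate G {y}" and ?W = "generate G {w}"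
  define K where "K = (\<lambda>(u, v). u \<otimes> v) ` (?U \<times> ?W)"
  have U: "subgroup ?U G" and W: "subgroup ?W G" using generate_subgroup1 y w by auto
  note Uc = subgroup.mem_carrier[OF U] and Wc = subgroup.mem_carrier[OF W]
  have nrm: "v \<otimes> u \<otimes> inv v \<in> ?U" if "v \<in> ?W" "u \<in> ?U" for u v
    using generate_cases_nat[OF w that(1)] normalizes_generate[OF y(1) w n that(2)] by metis
  have KI: "u \<otimes> v \<in> K" if "u \<in> ?U" "v \<in> ?W" for u v using that by (auto simp: K_def)
  have KE: "\<exists>u v. u \<in> ?U \<and> v \<in> ?W \<and> z = u \<otimes> v" if "z \<in> K" for z using that by (auto simp: K_def)
  have K: "subgroup K G"
  proof (rule subgroupI)
    show "K \<subseteq> carrier G" using Uc Wc by (auto simp: K_def)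
    show "K \<noteq> {}" using KI self_in_generate by blast
  next
    fix z assume "z \<in> K"
    then obtain u v where z: "u \<in> ?U" "v \<in> ?W" "z = u \<otimes> v" using KE by blast
    have iv: "inv v \<in> ?W" and iu: "inv u \<in> ?U" using z U W by (auto simp: subgroup.m_inv_closed)
    have "inv z = (inv v \<otimes> inv u \<otimes> inv (inv v)) \<otimes> inv v"
      using z Uc Wc by (simp add: inv_mult_group m_assoc)
    then show "inv z \<in> K" using KI[OF nrm[OF iv iu] iv] by simp
  next
    fix z z' assume "z \<in> K" "z' \<in> K"
    then obtain u v u' v' where z: "u \<in> ?U" "v \<in> ?W" "z = u \<otimes> v" "u' \<in> ?U" "v' \<in> ?W" "z' = u' \<otimes> v'"
      using KE by metis
    have "v \<otimes> u' = (v \<otimes> u' \<otimes> inv v) \<otimes> v" using z Uc Wc by (simp add: m_assoc)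
    then have "z \<otimes> z' = (u \<otimes> (v \<otimes> u' \<otimes> inv v)) \<otimes> (v \<otimes> v')"
      using z Uc[OF nrm[OF z(2,4)]] Uc[OF z(1)] Uc[OF z(4)] Wc[OF z(2)] Wc[OF z(5)]
      by (metis m_assoc m_closed)
    then show "z \<otimes> z' \<in> K"
      using KI nrm[OF z(2,4)] z U W by (simp add: subgroup.m_closed)
  qed
  have UK: "?U \<subseteq> K"
  proof
    fix u assume "u \<in> ?U"
    then show "u \<in> K" using KI[of u \<one>] subgroup.one_closed[OF W] Uc by simp
  qed
  have WK: "?W \<subseteq> K"
  proof
    fix v assume "v \<in> ?W"
    then show "v \<in> K" using KI[of \<one> v] subgroup.one_closed[OF U] Wc by simp
  qed
  have cU: "card ?U = p ^ k" using generate_pow_card[OF y(1)] y(2) by simp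
  have "(\<lambda>(u, v). u \<otimes> \<one> \<otimes> v) ` (?U \<times> ?W) = K"
    unfolding K_def using Uc by (intro image_cong) auto
  then have "card ?U * card ?W = card K * card {s \<in> ?U. inv \<one> \<otimes> s \<otimes> \<one> \<in> ?W}"
    using card_double_coset[OF U W one_closed] by simp
  \<comment> \<open>Product formula: |<y>| |<w>| is |K| times the order of the intersection.\<close>
  then have Kdvd: "card K dvd p ^ k * ord w"
    using cU generate_pow_card[OF w] by (metis dvd_triv_left)
  have "p_hypo_elementary G p K"
  proof (cases "p dvd ord w")
    case False
    obtain c where c: "card K = p ^ k * c"
      using card_subgroup_dvd[OF U K UK] cU by (metis dvdE)
    then have "c dvd ord w" using Kdvd p_gt_1 by simp
    then have "\<not> p dvd c" using False dvd_trans by blast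
    then have mK: "multiplicity p (card K) = k"
      using c card_subgroup_pos[OF K] prime_p p_gt_1
      by (simp add: prime_elem_multiplicity_mult_distrib prime_elem_multiplicity_power_distrib
          not_dvd_imp_multiplicity_0)
    interpret GK: group "G\<lparr>carrier := K\<rparr>"
      using K subgroup.subgroup_is_group is_group by blast
    interpret GW: group "G\<lparr>carrier := ?W\<rparr>"
      using W subgroup.subgroup_is_group is_group by blast
    have UsubK: "subgroup ?U (G\<lparr>carrier := K\<rparr>)" using subgroup_incl[OF U K UK] .
    have nU: "?U \<lhd> G\<lparr>carrier := K\<rparr>"
    proof -
      have "z \<otimes> u \<otimes> inv z \<in> ?U" if z: "z \<in> K" and u: "u \<in> ?U" for z u
      proof -
        obtain a v where av: "a \<in> ?U" "v \<in> ?W" "z = a \<otimes> v" using KE[OF z] by blast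
        then have "z \<otimes> u \<otimes> inv z = a \<otimes> (v \<otimes> u \<otimes> inv v) \<otimes> inv a"
          using conj_conj[of a v u] Uc Wc u by simp
        then show ?thesis using nrm[OF av(2) u] av U by (simp add: subgroup.m_closed subgroup.m_inv_closed)
      qed
      then show ?thesis using GK.normal_inv_iff UsubK m_inv_consistent[OF K] by simp
    qed
    interpret nU: normal ?U "G\<lparr>carrier := K\<rparr>" by (rule nU)
    let ?f = "\<lambda>z. ?U #>\<^bsub>G\<lparr>carrier := K\<rparr>\<^esub> z"
    \<comment> \<open>As K = <y> <w>, every coset of <y> contains an element of <w>, so the quotient
      map stays surjective when restricted to <w>.\<close>
    have "?f \<in> epi (G\<lparr>carrier := ?W\<rparr>) (G\<lparr>carrier := K\<rparr> Mod ?U)"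
    proof -
      have hom: "?f \<in> hom (G\<lparr>carrier := K\<rparr>) (G\<lparr>carrier := K\<rparr> Mod ?U)" by (rule nU.r_coset_hom_Mod)
      have "?f \<in> hom (G\<lparr>carrier := ?W\<rparr>) (G\<lparr>carrier := K\<rparr> Mod ?U)"
        using hom WK by (auto simp: hom_def Pi_def subset_iff)
      moreover have "?f ` ?W = carrier (G\<lparr>carrier := K\<rparr> Mod ?U)"
      proof (intro equalityI subsetI)
        fix C assume "C \<in> carrier (G\<lparr>carrier := K\<rparr> Mod ?U)"
        then obtain z where z: "z \<in> K" "C = ?f z" by (auto simp: carrier_FactGroup)
        then obtain u v where uv: "u \<in> ?U" "v \<in> ?W" "z = u \<otimes> v" using KE by blast
        have "?f z = ?f v"
        proof (rule GK.repr_independence[OF _ _ UsubK])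
          show "z \<in> carrier (G\<lparr>carrier := K\<rparr>)" using z by simp
          have "v = inv u \<otimes> z" using uv Uc Wc by (simp flip: m_assoc)
          then show "v \<in> ?U #>\<^bsub>G\<lparr>carrier := K\<rparr>\<^esub> z"
            using uv U by (auto simp: r_coset_def intro!: bexI[of _ "inv u"] subgroup.m_inv_closed)
        qed
        then show "C \<in> ?f ` ?W" using uv z by blast
      qed (use WK in \<open>auto simp: carrier_FactGroup\<close>)
      ultimately show ?thesis by (simp add: epi_def)
    qed
    moreover have "cyclic_group (G\<lparr>carrier := ?W\<rparr>)"
      using cyclic_subgroup_iff[OF W] self_in_generate by blast
    ultimately have "cyclic_group (G\<lparr>carrier := K\<rparr> Mod ?U)"
      using GW.cyclic_group_epimorphic_image nU.factorgroup_is_group by blast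
    then show ?thesis
      unfolding p_hypo_elementary_def using K UsubK nU cU mK by blast
  next
    case True
    then have "ord w = p ^ l" using pw by blast
    then have "card K dvd p ^ (k + l)" using Kdvd by (simp add: power_add)
    then obtain i where "card K = p ^ i" using divides_primepow_nat[OF prime_p] by blast
    then show ?thesis using p_hypo_elementary_p_subgroup[OF K] by blast
  qed
  then obtain g where g: "g \<in> K" "K = generate G {g}" using hyp cyclic_subgroup_iff[OF K] by blast
  moreover have "y \<in> K" "w \<in> K" using UK WK self_in_generate by blast+
  ultimately show ?thesis using generate_commute[of g w y] subgroup.mem_carrier[OF K] by blast
qed

lemma same_ord_in_cyclic:
  assumes x: "x \<in> carrier G" "ord x = p ^ a" and u: "u \<in> generate G {x}" and v: "v \<in> generate G {x}"
    and "ord v = ord u"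
  shows "v \<in> generate G {u}"
proof -
  let ?X = "generate G {x}"
  have X: "subgroup ?X G" using generate_subgroup1 x by blast
  have uc: "u \<in> carrier G" using subgroup.mem_carrier[OF X u] .
  have "ord u dvd p ^ a" using ord_dvd_card[OF X u] generate_pow_card[OF x(1)] x by simp
  then obtain j where j: "j \<le> a" "ord u = p ^ j" using divides_primepow_nat[OF prime_p] by blast
  have Usub: "subgroup (generate G {u}) G" using generate_subgroup1 uc by blast
  have UX: "generate G {u} \<subseteq> ?X" using generate_subgroup_incl[OF _ X, of "{u}"] u by simp
  have cU: "card (generate G {u}) = p ^ j" using generate_pow_card[OF uc] j by simp
  have "generate G {u} = {y \<in> ?X. ord y \<le> p ^ j}"
  proof (rule card_seteq)
    show "finite {y \<in> ?X. ord y \<le> p ^ j}" using subgroup_finite[OF X] by simp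
    show "generate G {u} \<subseteq> {y \<in> ?X. ord y \<le> p ^ j}"
      using UX ord_dvd_card[OF Usub] cU p_gt_1 by (auto intro: dvd_imp_le)
    show "card {y \<in> ?X. ord y \<le> p ^ j} \<le> card (generate G {u})"
      using card_upto_part_cyclic_le[OF x j(1)] cU by simp
  qed
  then show ?thesis using v assms(5) j by simp
qed

text \<open>The Sylow subgroup <x> is itself p-hypo-elementary, hence cyclic. If g conjugates u to v
  inside it, both have the same order, so v lies in <u> and g normalises <u>. The p-part and the
  p'-part of g are powers of g and normalise <u> too; each of them commutes with u, so g does, and u
  = v.\<close>

lemma defect_eq_0_if_hypo_elementary_cyclic:
  assumes hyp: "\<And>K. p_hypo_elementary G p K \<Longrightarrow> cyclic_group (G\<lparr>carrier := K\<rparr>)"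
  shows "defect (carrier G) = 0"
proof -
  note H = subgroup_self
  obtain P where P: "subgroup P G" "card P = ppart (carrier G)"
    using sylow_subgroup_exists[OF H prime_p, of "multiplicity p (card (carrier G))"]
    by (auto simp: ppart_def multiplicity_dvd)
  then obtain x where x: "x \<in> P" "P = generate G {x}"
    using hyp p_hypo_elementary_p_subgroup cyclic_subgroup_iff unfolding ppart_def by metis
  have xc: "x \<in> carrier G" using subgroup.mem_carrier[OF P(1) x(1)] .
  have ox: "ord x = ppart (carrier G)" using generate_pow_card[OF xc] P x by simp
  note ox' = ox[unfolded ppart_def]
  have "u = v" if u: "u \<in> generate G {x}" and v: "v \<in> generate G {x}" and cl: "v \<in> cls (carrier G) u" for u v
  proof -
    obtain g where g: "g \<in> carrier G" "v = g \<otimes> u \<otimes> inv g" using cl by (auto simp: cls_def)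
    have uc: "u \<in> carrier G" "pp u = u" using prime_power_ord_in_generate[OF xc ox' u] by auto
    then obtain k where k: "ord u = p ^ k" using pp_self_iff by blast
    have n: "g \<otimes> u \<otimes> inv g \<in> generate G {u}"
      using same_ord_in_cyclic[OF xc ox' u v] g ord_conj uc by simp
    have comm: "w \<otimes> u = u \<otimes> w"
      if w: "w \<in> generate G {g}" "(\<exists>l. ord w = p ^ l) \<or> \<not> p dvd ord w" for w
    proof -
      obtain i :: nat where i: "w = g [^] i" using generate_cases_nat[OF g(1) w(1)] .
      have "w \<otimes> u \<otimes> inv w \<in> generate G {u}"
        unfolding i using normalizes_generate[OF uc(1) g(1) n self_in_generate] .
      moreover have "w \<in> carrier G" using i g by simp
      ultimately show ?thesis
        using commute_if_hypo_elementary_cyclic[OF hyp uc(1) k] w(2) by blast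
    qed
    have gsub: "subgroup (generate G {g}) G" using generate_subgroup1 g by blast
    have ppg: "pp g \<in> generate G {g}" using pp_in_subgroup[OF gsub self_in_generate] .
    have 1: "pp g \<otimes> u = u \<otimes> pp g" using comm[OF ppg] ord_pp[OF g(1)] by blast
    \<comment> \<open>The p'-part of \<open>g\<close>.\<close>
    let ?r = "g \<otimes> inv (pp g)"
    have rg: "?r \<in> generate G {g}"
      using gsub ppg self_in_generate by (simp add: subgroup.m_closed subgroup.m_inv_closed)
    have rc: "?r \<in> carrier G" using g by simp
    have "pp ?r = pp g \<otimes> pp (inv (pp g))"
      using g ppg gsub by (intro pp_mult generate_commute[OF g(1)] self_in_generate) (auto simp: subgroup.m_inv_closed)
    then have "pp ?r = \<one>" using g pp_inv pp_idem by simp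
    then have 2: "?r \<otimes> u = u \<otimes> ?r" using comm[OF rg] pp_eq_one_iff[OF rc] by blast
    have "g = ?r \<otimes> pp g" using g by (simp add: m_assoc)
    then have "g \<otimes> u = u \<otimes> g" using 1 2 rc uc(1) pp_closed[OF g(1)] by (metis m_assoc)
    then show ?thesis using g uc conj_eq_iff[of g u u] by simp
  qed
  then have "\<forall>j<multiplicity p (card (carrier G)). card (upto_part (carrier G) j) = p ^ j * preg (carrier G)"
    using card_upto_part_eq[OF H xc ox] by simp
  then show ?thesis using defect_eq_0_iff[OF H] by blast
qed


subsection \<open>Groups of defect zero\<close>

text \<open>The centraliser C of \<open>y\<close> contains <y>, so its order has the full p-part. As
  \<open>y\<close> is central in C, elements of <y> are pairwise nonconjugate there, and the count
  with j = 0 gives exactly \<open>preg ?C\<close> p-regular elements in C.\<close>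

lemma card_fibre_sylow_generator:
  assumes y: "y \<in> carrier G" "ord y = ppart (carrier G)"
  shows "card (fibre (carrier G) y) = preg (carrier G)"
proof -
  let ?C = "cent (carrier G) y"
  let ?a = "multiplicity p (card (carrier G))"
  note H = subgroup_self
  have ppy: "pp y = y" using pp_eq_self[OF y(1)] y(2) by (simp add: ppart_def)
  have C: "subgroup ?C G" using cent_subgroup[OF H y(1)] .
  have yC: "y \<in> ?C" using y by (simp add: cent_def)
  have cc: "card (cls (carrier G) y) * card ?C = card (carrier G)" using card_cls[OF H y(1)] .
  have "p ^ ?a dvd card ?C" using ord_dvd_card[OF C yC] y(2) by (simp add: ppart_def)
  then have "?a \<le> multiplicity p (card ?C)"
    using card_subgroup_pos[OF C] p_gt_1 by (intro multiplicity_geI) auto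
  moreover have "multiplicity p (card ?C) \<le> ?a"
    using cc card_subgroup_pos[OF H] by (intro dvd_imp_multiplicity_le) (auto, metis dvd_triv_right)
  ultimately have pC: "ppart ?C = ppart (carrier G)" by (simp add: ppart_def)
  have "u = v" if u: "u \<in> generate G {y}" and cl: "v \<in> cls ?C u" for u v
  proof -
    obtain h where h: "h \<in> ?C" "v = h \<otimes> u \<otimes> inv h" using cl by (auto simp: cls_def)
    obtain i :: nat where i: "u = y [^] i" using generate_cases_nat[OF y(1) u] .
    have hc: "h \<in> carrier G" "h \<otimes> y = y \<otimes> h" using h by (auto simp: cent_def)
    then have "h \<otimes> y \<otimes> inv h = y" using y conj_eq_iff[of h y y] by simp
    then show ?thesis using pow_conj[OF hc(1) y(1), of i] h i by simp
  qed
  then have "card (reg ?C) = preg ?C"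
    using card_upto_part_eq[OF C yC, of 0] y pC upto_part_0[OF C] by simp
  then have cf: "card (fibre (carrier G) y) = card (cls (carrier G) y) * preg ?C"
    using card_fibre[OF H y(1) ppy] by simp
  have "ppart (carrier G) * (card (cls (carrier G) y) * preg ?C) = ppart (carrier G) * preg (carrier G)"
    using cc card_split[of ?C] card_split[of "carrier G"] pC by (metis mult.left_commute)
  moreover have "ppart (carrier G) > 0" using p_gt_1 by (simp add: ppart_def)
  ultimately show ?thesis using cf by simp
qed

lemma conj_in_sylow:
  assumes x: "x \<in> carrier G" "ord x = ppart (carrier G)" and z: "subgroup U G" "card U = p ^ b"
  obtains h where "h \<in> carrier G" "\<And>u. u \<in> U \<Longrightarrow> h \<otimes> u \<otimes> inv h \<in> generate G {x}"
proof -
  have "card (generate G {x}) = ppart (carrier G)" using generate_pow_card[OF x(1)] x(2) by simp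
  then show ?thesis
    using p_subgroup_conj_into_sylow[OF subgroup_self generate_subgroup1[OF x(1)] _ _ z(1) _ z(2)]
      subgroup.subset[OF generate_subgroup1[OF x(1)]] subgroup.subset[OF z(1)] that by metis
qed

text \<open>With a = b + 1, defect zero leaves p^b (p - 1) \<open>preg\<close> elements whose order
  has the full p-part. They are covered by the sections of the p^b (p - 1) generators of <x>, of
  size \<open>preg\<close> each. Two conjugate generators share a section, and then one section is
  missing.\<close>

lemma sylow_generators_nonconj:
  assumes d0: "defect (carrier G) = 0" and x: "x \<in> carrier G" "ord x = ppart (carrier G)"
    and v: "v \<in> generate G {x}" "v \<in> cls (carrier G) x"
  shows "v = x"
proof (rule ccontr)
  assume ne: "v \<noteq> x"
  note H = subgroup_self
  define a where "a = multiplicity p (card (carrier G))"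
  have ox: "ord x = p ^ a" using x by (simp add: ppart_def a_def)
  have vc: "v \<in> carrier G" using v(1) subgroup.mem_carrier[OF generate_subgroup1[OF x(1)]] by blast
  obtain g where g: "g \<in> carrier G" "v = g \<otimes> x \<otimes> inv g" using v(2) by (auto simp: cls_def)
  have ov: "ord v = ord x" using ord_conj[OF g(1) x(1)] g by simp
  \<comment> \<open>Needed for the predecessor \<open>b\<close> of \<open>a\<close>; in a trivial
    Sylow subgroup there is nothing to distinguish.\<close>
  have "a \<noteq> 0"
  proof
    assume "a = 0"
    then have "x = \<one>" "v = \<one>" using ord_eq_1 ox ov x(1) vc by simp_all
    then show False using ne by simp
  qed
  then obtain b where b: "a = Suc b" by (cases a) auto
  define Gen where "Gen = {h \<in> carrier G. generate G {h} = generate G {x}}"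
  have cGen: "card Gen = p ^ b * (p - 1)"
    using card_generators[OF x(1)] ox totient_prime_power_Suc[OF prime_p, of b]
    by (simp add: Gen_def b)
  have ordGen: "ord h = ord x" if "h \<in> Gen" for h
    using that generate_pow_card[of h] generate_pow_card[OF x(1)] by (simp add: Gen_def)
  have GenI: "h \<in> Gen" if h: "h \<in> generate G {x}" "ord h = ord x" for h
  proof -
    have hc: "h \<in> carrier G" using h subgroup.mem_carrier[OF generate_subgroup1[OF x(1)]] by blast
    have "generate G {h} \<subseteq> generate G {x}"
      using generate_subgroup_incl[OF _ generate_subgroup1[OF x(1)], of "{h}"] h by simp
    moreover have "card (generate G {h}) = card (generate G {x})"
      using generate_pow_card[OF hc] generate_pow_card[OF x(1)] h by simp
    ultimately have "generate G {h} = generate G {x}"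
      using card_subset_eq[OF subgroup_finite[OF generate_subgroup1[OF x(1)]]] by blast
    then show ?thesis using hc by (simp add: Gen_def)
  qed
  have finGen: "finite Gen" using finite_carrier by (simp add: Gen_def)
  have xG: "x \<in> Gen" and vG: "v \<in> Gen" using GenI self_in_generate v(1) ov by auto
  \<comment> \<open>By Sylow the p-part of such an element is conjugate into <x>, where its order
    makes it a generator. The section of \<open>v\<close> can be left out, being also the section of
    \<open>x\<close>.\<close>
  have cover: "carrier G - upto_part (carrier G) b \<subseteq> (\<Union>y\<in>Gen - {v}. fibre (carrier G) y)"
  proof
    fix z assume z: "z \<in> carrier G - upto_part (carrier G) b"
    then have zc: "z \<in> carrier G" and "multiplicity p (ord z) > b" by (auto simp: upto_part_def)
    then have "multiplicity p (ord z) = a"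
      using multiplicity_ord_le[OF H zc] b by (simp add: a_def)
    then have oz: "ord (pp z) = p ^ a" using ord_pp[OF zc] by simp
    have ppz: "pp z \<in> carrier G" using zc by simp
    obtain h where h: "h \<in> carrier G" "\<And>u. u \<in> generate G {pp z} \<Longrightarrow> h \<otimes> u \<otimes> inv h \<in> generate G {x}"
      using conj_in_sylow[OF x generate_subgroup1[OF ppz], of a] generate_pow_card[OF ppz] oz by metis
    define y where "y = h \<otimes> pp z \<otimes> inv h"
    have yG: "y \<in> Gen"
      unfolding y_def using h self_in_generate ord_conj[OF h(1) ppz] oz ox by (intro GenI) auto
    have yc: "y \<in> carrier G" using yG by (simp add: Gen_def)
    have "pp z = inv h \<otimes> y \<otimes> h" using conj_inv_conj[OF h(1) ppz] by (simp add: y_def)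
    then have "pp z \<in> cls (carrier G) y"
      unfolding cls_def using h(1) by (intro image_eqI[of _ _ "inv h"]) auto
    then have zy: "z \<in> fibre (carrier G) y" using zc by (simp add: fibre_def)
    have "cls (carrier G) v = cls (carrier G) x" using cls_eq[OF H x(1) v(2)] .
    then have "fibre (carrier G) v = fibre (carrier G) x" by (simp add: fibre_def)
    then show "z \<in> (\<Union>y\<in>Gen - {v}. fibre (carrier G) y)"
      using zy yG xG ne by (cases "y = v") auto
  qed
  have "card (carrier G - upto_part (carrier G) b) \<le> card (\<Union>y\<in>Gen - {v}. fibre (carrier G) y)"
    using finGen finite_carrier by (intro card_mono[OF _ cover]) (auto simp: fibre_def)
  also have "\<dots> \<le> (\<Sum>y\<in>Gen - {v}. card (fibre (carrier G) y))"
    using finGen by (intro card_UN_le) auto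
  also have "\<dots> = (\<Sum>y\<in>Gen - {v}. preg (carrier G))"
    using ordGen x(2) by (intro sum.cong card_fibre_sylow_generator) (auto simp: Gen_def)
  also have "\<dots> = (p ^ b * (p - 1) - 1) * preg (carrier G)" using vG finGen cGen by simp
  finally have le: "card (carrier G - upto_part (carrier G) b) \<le> (p ^ b * (p - 1) - 1) * preg (carrier G)" .
  have "card (upto_part (carrier G) b) = p ^ b * preg (carrier G)"
    using d0 defect_eq_0_iff[OF H] b by (simp add: a_def)
  moreover have "card (carrier G) = p ^ a * preg (carrier G)"
    using card_split[of "carrier G"] unfolding ppart_def a_def .
  ultimately have "p ^ a * preg (carrier G) \<le> p ^ b * preg (carrier G) + (p ^ b * (p - 1) - 1) * preg (carrier G)"
    using card_above_part[OF H, of b] le by simp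
  then have "p ^ a * preg (carrier G) \<le> (p ^ b + (p ^ b * (p - 1) - 1)) * preg (carrier G)"
    by (simp add: add_mult_distrib)
  then have "p ^ a \<le> p ^ b + (p ^ b * (p - 1) - 1)" using preg_pos[OF H] by simp
  moreover have "p ^ a = p ^ b + p ^ b * (p - 1)" using p_gt_1 by (simp add: b algebra_simps)
  moreover have "p ^ b * (p - 1) > 0" using p_gt_1 by simp
  ultimately show False by linarith
qed

text \<open>Burnside's argument: the normaliser of an abelian Sylow subgroup controls its fusion.\<close>
lemma no_fusion_in_sylow:
  assumes d0: "defect (carrier G) = 0" and x: "x \<in> carrier G" "ord x = ppart (carrier G)"
    and y: "y \<in> generate G {x}" and s: "s \<in> carrier G" and sy: "s \<otimes> y \<otimes> inv s \<in> generate G {x}"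
  shows "s \<otimes> y \<otimes> inv s = y"
proof -
  note H = subgroup_self
  let ?X = "generate G {x}"
  have X: "subgroup ?X G" using generate_subgroup1 x by blast
  define z where "z = s \<otimes> y \<otimes> inv s"
  have yc: "y \<in> carrier G" and zc: "z \<in> carrier G"
    using subgroup.mem_carrier[OF X] y s by (auto simp: z_def)
  \<comment> \<open>Both <x> and its conjugate by \<open>s\<close> centralise \<open>z\<close>: the
    first because \<open>z\<close> lies in <x>, the second because \<open>z\<close> is a power of
    \<open>?x'\<close>. They are Sylow subgroups of \<open>?C\<close>, hence conjugate
    there.\<close>
  let ?C = "cent (carrier G) z"
  have C: "subgroup ?C G" using cent_subgroup[OF H zc] .
  have xC: "x \<in> ?C"
    using generate_commute[OF x(1) self_in_generate sy] x(1) by (simp add: cent_def z_def)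
  let ?x' = "s \<otimes> x \<otimes> inv s"
  have x'c: "?x' \<in> carrier G" using s x by simp
  obtain i :: nat where i: "y = x [^] i" using generate_cases_nat[OF x(1) y] .
  have z: "z = ?x' [^] i" using pow_conj[OF s x(1)] i by (simp add: z_def)
  have x'C: "?x' \<in> ?C"
    using generate_commute[OF x'c self_in_generate pow_in_generate[OF x'c]] x'c
    by (simp add: cent_def z)
  have XC: "?X \<subseteq> ?C" using generate_subgroup_incl[OF _ C, of "{x}"] xC by simp
  have XC': "generate G {?x'} \<subseteq> ?C" using generate_subgroup_incl[OF _ C, of "{?x'}"] x'C by simp
  have cX: "card ?X = ppart (carrier G)" using generate_pow_card[OF x(1)] x(2) by simp
  have "card ?C dvd card (carrier G)" using card_subgroup_dvd[OF C H] subgroup.subset[OF C] by blast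
  then have "multiplicity p (card ?C) \<le> multiplicity p (card (carrier G))"
    using card_subgroup_pos[OF H] by (intro dvd_imp_multiplicity_le) auto
  moreover have "p ^ multiplicity p (card (carrier G)) dvd card ?C"
    using card_subgroup_dvd[OF X C XC] cX by (simp add: ppart_def)
  then have "multiplicity p (card (carrier G)) \<le> multiplicity p (card ?C)"
    using card_subgroup_pos[OF C] p_gt_1 by (intro multiplicity_geI) auto
  ultimately have "ppart ?C = ppart (carrier G)" by (simp add: ppart_def)
  then have cX': "card ?X = ppart ?C" using cX by simp
  have "card (generate G {?x'}) = p ^ multiplicity p (card (carrier G))"
    using generate_pow_card[OF x'c] ord_conj[OF s x(1)] x(2) by (simp add: ppart_def)
  then obtain c where c: "c \<in> ?C" "\<And>u. u \<in> generate G {?x'} \<Longrightarrow> c \<otimes> u \<otimes> inv c \<in> ?X"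
    using p_subgroup_conj_into_sylow[OF C X XC cX' generate_subgroup1[OF x'c] XC'] by metis
  have cc: "c \<in> carrier G" "c \<otimes> z = z \<otimes> c" using c(1) by (auto simp: cent_def)
  have cs: "c \<otimes> ?x' \<otimes> inv c = (c \<otimes> s) \<otimes> x \<otimes> inv (c \<otimes> s)"
    using conj_conj[OF cc(1) s x(1)] .
  \<comment> \<open>Conjugation by \<open>c \<otimes> s\<close> sends \<open>x\<close> to a
    conjugate inside <x>, which can only be \<open>x\<close>; so it fixes the power \<open>y\<close>
    of \<open>x\<close>. Since \<open>c\<close> centralises \<open>z\<close>, this gives z = c z
    c^-1 = y.\<close>
  have "c \<otimes> ?x' \<otimes> inv c = x"
  proof (rule sylow_generators_nonconj[OF d0 x])
    show "c \<otimes> ?x' \<otimes> inv c \<in> ?X" using c(2) self_in_generate by blast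
    show "c \<otimes> ?x' \<otimes> inv c \<in> cls (carrier G) x"
      unfolding cs cls_def using cc(1) s by blast
  qed
  then have "(c \<otimes> s) \<otimes> y \<otimes> inv (c \<otimes> s) = y"
    using pow_conj[of "c \<otimes> s" x i] cs cc(1) s x(1) i by simp
  then have "c \<otimes> z \<otimes> inv c = y" using conj_conj[OF cc(1) s yc] by (simp add: z_def)
  then have "z = y" using conj_eq_iff[OF cc(1) zc zc] cc(2) by simp
  then show ?thesis by (simp add: z_def)
qed

text \<open>With p^(b+1) the p-part of |G|, the count N_b is less than |G|, so some element has
  order divisible by the full p-part, and its p-part is as required.\<close>

lemma exists_sylow_generator:
  assumes d0: "defect (carrier G) = 0"
  obtains x where "x \<in> carrier G" "ord x = ppart (carrier G)"
proof (cases "multiplicity p (card (carrier G))")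
  case 0
  then show ?thesis using that[of \<one>] by (simp add: ppart_def)
next
  case (Suc b)
  note H = subgroup_self
  have "card (upto_part (carrier G) b) = p ^ b * preg (carrier G)"
    using d0 defect_eq_0_iff[OF H] Suc by simp
  also have "\<dots> < p ^ Suc b * preg (carrier G)" using p_gt_1 preg_pos[OF H] by simp
  also have "\<dots> = card (carrier G)" using card_split[of "carrier G"] unfolding ppart_def Suc by simp
  finally have "upto_part (carrier G) b \<noteq> carrier G" by auto
  then obtain g where g: "g \<in> carrier G" "multiplicity p (ord g) > b"
    unfolding upto_part_def using not_le by blast
  then have "multiplicity p (ord g) = Suc b" using multiplicity_ord_le[OF H g(1)] Suc by simp
  then show ?thesis using that[of "pp g"] ord_pp[OF g(1)] g Suc by (simp add: ppart_def)
qed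

text \<open>A lift of a generator of K/Q yields an element r whose order is prime to p and a
  multiple of |K/Q|. It commutes with the generator y of Q, so the order of r y is a multiple of
  |K|.\<close>

lemma cyclic_if_central_sylow:
  assumes K: "subgroup K G" and Q: "subgroup Q (G\<lparr>carrier := K\<rparr>)" "card Q = p ^ multiplicity p (card K)"
    and nQ: "Q \<lhd> G\<lparr>carrier := K\<rparr>" and cyc: "cyclic_group (G\<lparr>carrier := K\<rparr> Mod Q)"
    and y: "y \<in> Q" "Q = generate G {y}" and central: "\<And>s. s \<in> K \<Longrightarrow> s \<otimes> y = y \<otimes> s"
  shows "cyclic_group (G\<lparr>carrier := K\<rparr>)"
proof -
  define c where "c = multiplicity p (card K)"
  interpret GK: group "G\<lparr>carrier := K\<rparr>"
    using K subgroup.subgroup_is_group is_group by blast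
  interpret nQ: normal Q "G\<lparr>carrier := K\<rparr>" by (rule nQ)
  let ?M = "G\<lparr>carrier := K\<rparr> Mod Q"
  interpret M: group ?M by (rule nQ.factorgroup_is_group)
  note Kc = subgroup.mem_carrier[OF K]
  have QG: "subgroup Q G" using incl_subgroup[OF K Q(1)] .
  have QK: "Q \<subseteq> K" using subgroup.subset[OF Q(1)] by simp
  have yc: "y \<in> carrier G" using y QK Kc by blast
  have cQ: "card Q = p ^ c" using Q(2) by (simp add: c_def)
  have oM: "order ?M * p ^ c = card K"
    using GK.lagrange[OF Q(1)] cQ by (simp add: order_def FactGroup_def)
  have cK: "card K = p ^ c * preg K" using card_split[of K] unfolding ppart_def c_def .
  have "order ?M = preg K" using oM cK p_gt_1 by (simp add: mult.commute)
  obtain t where t: "t \<in> carrier ?M" "subgroup_generated ?M {t} = ?M"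
    using cyc unfolding cyclic_group_def by blast
  have ot: "M.ord t = preg K" using M.cyclic_order_is_ord[OF t(1)] t(2) \<open>order ?M = preg K\<close> by simp
  obtain s where s: "s \<in> K" "t = Q #>\<^bsub>G\<lparr>carrier := K\<rparr>\<^esub> s" using t(1) by (auto simp: carrier_FactGroup)
  have sc: "s \<in> carrier G" using s Kc by blast
  have tp: "t [^]\<^bsub>?M\<^esub> n = Q #>\<^bsub>G\<lparr>carrier := K\<rparr>\<^esub> (s [^] n)" for n :: nat
    using nQ.FactGroup_pow[of s n] s by (simp flip: nat_pow_consistent)
  have mem: "t [^]\<^bsub>?M\<^esub> n = \<one>\<^bsub>?M\<^esub> \<longleftrightarrow> s [^] n \<in> Q" for n :: nat
    unfolding tp one_FactGroup
    using GK.coset_join1[OF _ _ Q(1), of "s [^] n"] GK.coset_join2[OF _ Q(1), of "s [^] n"]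
      subgroup_pow_closed[OF K s(1), of n] by auto
  \<comment> \<open>Raising to |Q| removes the p-part of \<open>s\<close>, while the image in K/Q
    still generates, because |K/Q| is prime to p.\<close>
  define r where "r = s [^] (p ^ c)"
  have rK: "r \<in> K" using subgroup_pow_closed[OF K s(1)] by (simp add: r_def)
  have rc: "r \<in> carrier G" using rK Kc by blast
  have iff: "preg K dvd n \<longleftrightarrow> s [^] n \<in> Q" for n :: nat
    using mem[of n] M.pow_eq_id[OF t(1), of n] ot by simp
  have r1: "r [^] preg K = \<one>"
  proof -
    have "s [^] preg K \<in> Q" using iff[of "preg K"] by simp
    then have "ord (s [^] preg K) dvd p ^ c" using ord_dvd_card[OF QG] cQ by metis
    then have "(s [^] preg K) [^] (p ^ c) = \<one>" using pow_eq_id sc by simp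
    then show ?thesis using sc by (simp add: r_def nat_pow_pow mult.commute)
  qed
  have r2: "preg K dvd n" if "r [^] n = \<one>" for n :: nat
  proof -
    have "s [^] (p ^ c * n) = \<one>" using that sc by (simp add: r_def nat_pow_pow)
    then have "preg K dvd p ^ c * n" using iff[of "p ^ c * n"] subgroup.one_closed[OF QG] by simp
    then show ?thesis
      using coprime_p_power[OF preg_not_dvd[OF K], of c]
      by (simp add: coprime_commute coprime_dvd_mult_right_iff)
  qed
  have "ord r dvd preg K" using r1 pow_eq_id[OF rc] by blast
  then have "\<not> p dvd ord r" using preg_not_dvd[OF K] dvd_trans by blast
  then have ppr: "pp r = \<one>" using pp_eq_one_iff[OF rc] by blast
  have oy: "ord y = p ^ c" using generate_pow_card[OF yc] y(2) cQ by simp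
  then have ppy: "pp y = y" using pp_eq_self[OF yc] by blast
  have ry: "r \<otimes> y = y \<otimes> r" using central[OF rK] .
  define z where "z = r \<otimes> y"
  have zc: "z \<in> carrier G" using rc yc by (simp add: z_def)
  have ppz: "pp z = y" using pp_mult[OF ry rc yc] ppr ppy yc by (simp add: z_def)
  have "card K dvd ord z"
  proof -
    have "pp z [^] ord z = \<one>"
      using pp_in_subgroup[OF generate_subgroup1[OF zc] self_in_generate]
        ord_dvd_card[OF generate_subgroup1[OF zc]] generate_pow_card[OF zc] pow_eq_id pp_closed[OF zc]
      by metis
    then have yz: "y [^] ord z = \<one>" using ppz by simp
    then have 1: "p ^ c dvd ord z" using pow_eq_id[OF yc] oy by simp
    have "z [^] ord z = r [^] ord z \<otimes> y [^] ord z"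
      unfolding z_def using pow_mult_distrib[OF ry rc yc] by blast
    then have "r [^] ord z = \<one>" using yz zc rc by simp
    then have "preg K dvd ord z" using r2 by blast
    then show ?thesis
      unfolding cK using 1 coprime_p_power[OF preg_not_dvd[OF K]] by (intro divides_mult)
  qed
  then have "card K \<le> card (generate G {z})"
    using generate_pow_card[OF zc] ord_pos[OF zc] by (simp add: dvd_imp_le)
  moreover have zK: "z \<in> K" using rK y(1) QK K by (auto simp: z_def subgroup.m_closed)
  moreover have "generate G {z} \<subseteq> K" using generate_subgroup_incl[OF _ K, of "{z}"] zK by simp
  ultimately have "generate G {z} = K" using card_seteq[OF subgroup_finite[OF K]] by blast
  then show ?thesis using cyclic_subgroup_iff[OF K] zK by blast
qed

lemma hypo_elementary_cyclic_if_defect_eq_0: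
  assumes d0: "defect (carrier G) = 0" and hypo: "p_hypo_elementary G p K"
  shows "cyclic_group (G\<lparr>carrier := K\<rparr>)"
proof -
  from hypo obtain Q where K: "subgroup K G"
    and Q: "subgroup Q (G\<lparr>carrier := K\<rparr>)" "card Q = p ^ multiplicity p (card K)"
    and nQ: "Q \<lhd> G\<lparr>carrier := K\<rparr>" and cyc: "cyclic_group (G\<lparr>carrier := K\<rparr> Mod Q)"
    unfolding p_hypo_elementary_def by blast
  define c where "c = multiplicity p (card K)"
  have cQ: "card Q = p ^ c" using Q(2) by (simp add: c_def)
  note Kc = subgroup.mem_carrier[OF K]
  have QG: "subgroup Q G" using incl_subgroup[OF K Q(1)] .
  have QK: "Q \<subseteq> K" using subgroup.subset[OF Q(1)] by simp
  note Qc = subgroup.mem_carrier[OF QG]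
  interpret GK: group "G\<lparr>carrier := K\<rparr>"
    using K subgroup.subgroup_is_group is_group by blast
  have nrm: "s \<otimes> u \<otimes> inv s \<in> Q" if "s \<in> K" "u \<in> Q" for s u
    using nQ that GK.normal_inv_iff[of Q] m_inv_consistent[OF K] by auto
  obtain x0 where x0: "x0 \<in> carrier G" "ord x0 = ppart (carrier G)"
    using exists_sylow_generator[OF d0] .
  obtain h where h: "h \<in> carrier G" "\<And>u. u \<in> Q \<Longrightarrow> h \<otimes> u \<otimes> inv h \<in> generate G {x0}"
    using conj_in_sylow[OF x0 QG cQ] by metis
  \<comment> \<open>The Sylow generator is moved instead of \<open>Q\<close>, so that
    \<open>Q\<close> itself lies in <x> and \<open>K\<close> stays fixed.\<close>
  define x where "x = inv h \<otimes> x0 \<otimes> h"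
  have x: "x \<in> carrier G" "ord x = ppart (carrier G)"
    using h x0 ord_conj[of "inv h" x0] by (auto simp: x_def)
  define a where "a = multiplicity p (card (carrier G))"
  have ox: "ord x = p ^ a" using x by (simp add: ppart_def a_def)
  let ?X = "generate G {x}"
  have QX: "Q \<subseteq> ?X"
  proof
    fix u assume u: "u \<in> Q"
    obtain i :: nat where i: "h \<otimes> u \<otimes> inv h = x0 [^] i" using generate_cases_nat[OF x0(1) h(2)[OF u]] .
    have "u = inv h \<otimes> (h \<otimes> u \<otimes> inv h) \<otimes> h" using conj_inv_conj[OF h(1) Qc[OF u]] by simp
    also have "\<dots> = x [^] i" unfolding i using pow_conj[of "inv h" x0 i] h x0 by (simp add: x_def)
    finally show "u \<in> ?X" using pow_in_generate[OF x(1)] by simp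
  qed
  have X: "subgroup ?X G" using generate_subgroup1[OF x(1)] .
  have "p ^ c dvd p ^ a"
    using card_subgroup_dvd[OF QG X QX] cQ generate_pow_card[OF x(1)] ox by simp
  then have ca: "c \<le> a" using p_gt_1 by (simp add: dvd_power_iff_le)
  have Qeq: "Q = {y \<in> ?X. ord y \<le> p ^ c}"
  proof (rule card_seteq)
    show "finite {y \<in> ?X. ord y \<le> p ^ c}" using subgroup_finite[OF X] by simp
    show "Q \<subseteq> {y \<in> ?X. ord y \<le> p ^ c}"
      using QX ord_dvd_card[OF QG] cQ p_gt_1 by (auto intro: dvd_imp_le)
    show "card {y \<in> ?X. ord y \<le> p ^ c} \<le> card Q"
      using card_upto_part_cyclic_le[OF x(1) ox ca] cQ by simp
  qed
  define y where "y = x [^] (p ^ (a - c))"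
  have yc: "y \<in> carrier G" using x by (simp add: y_def)
  have "p ^ a = p ^ (a - c) * p ^ c" using ca by (simp flip: power_add)
  then have oy: "ord y = p ^ c"
    using ord_pow[OF x(1), of "p ^ (a - c)"] ox p_gt_1 by (simp add: y_def)
  have yX: "y \<in> ?X" using pow_in_generate[OF x(1)] by (simp add: y_def)
  have yQ: "y \<in> Q" using Qeq yX oy by simp
  have "generate G {y} \<subseteq> Q" using generate_subgroup_incl[OF _ QG, of "{y}"] yQ by simp
  then have Qy: "Q = generate G {y}"
    using card_subset_eq[OF subgroup_finite[OF QG]] generate_pow_card[OF yc] oy cQ by metis
  \<comment> \<open>Normality of \<open>Q\<close> keeps the conjugate inside the Sylow subgroup <x>,
    where absence of fusion forces it to be \<open>y\<close>.\<close>
  have "s \<otimes> y = y \<otimes> s" if s: "s \<in> K" for s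
  proof -
    have "s \<otimes> y \<otimes> inv s \<in> ?X" using nrm[OF s yQ] QX by blast
    then have "s \<otimes> y \<otimes> inv s = y" using no_fusion_in_sylow[OF d0 x yX] Kc[OF s] by blast
    then show ?thesis using conj_eq_iff[OF Kc[OF s] yc yc] by blast
  qed
  then show ?thesis using cyclic_if_central_sylow[OF K Q nQ cyc yQ Qy] by blast
qed

subsection \<open>Artin coefficients\<close>

lemma conj_image_carrier:
  assumes "g \<in> carrier G"
  shows "(\<lambda>h. g \<otimes> h \<otimes> inv g) ` carrier G = carrier G"
proof (intro equalityI subsetI)
  fix x assume x: "x \<in> carrier G"
  have "x = g \<otimes> (inv g \<otimes> x \<otimes> g) \<otimes> inv g" using conj_inv_conj[of "inv g" x] assms x by simp
  then show "x \<in> (\<lambda>h. g \<otimes> h \<otimes> inv g) ` carrier G" using assms x by blast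
qed (use assms in auto)

lemma conj_image_conj_image:
  assumes "g \<in> carrier G" "k \<in> carrier G" "H \<subseteq> carrier G"
  shows "(\<lambda>h. k \<otimes> h \<otimes> inv k) ` (\<lambda>h. g \<otimes> h \<otimes> inv g) ` H = (\<lambda>h. (k \<otimes> g) \<otimes> h \<otimes> inv (k \<otimes> g)) ` H"
  unfolding image_image
proof (rule image_cong)
  fix x assume "x \<in> H"
  then show "k \<otimes> (g \<otimes> x \<otimes> inv g) \<otimes> inv k = (k \<otimes> g) \<otimes> x \<otimes> inv (k \<otimes> g)"
    using conj_conj[of k g x] assms by blast
qed simp

lemma conj_image_generate:
  assumes "t \<in> carrier G" "g \<in> carrier G"
  shows "(\<lambda>h. t \<otimes> h \<otimes> inv t) ` generate G {g} = generate G {t \<otimes> g \<otimes> inv t}"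
proof -
  have "t \<otimes> g \<otimes> inv t \<in> carrier G" using assms by simp
  then show ?thesis
    using pow_conj[OF assms]
    by (auto simp: generate_pow_on_finite_carrier[OF finite_carrier] assms)
qed

lemma self_in_conj_class:
  assumes "H \<subseteq> carrier G"
  shows "H \<in> conj_class G H"
proof -
  have "(\<lambda>h. \<one> \<otimes> h \<otimes> inv \<one>) ` H = (\<lambda>h. h) ` H" using assms by (intro image_cong) auto
  then have "H = (\<lambda>h. \<one> \<otimes> h \<otimes> inv \<one>) ` H" by simp
  then show ?thesis unfolding conj_class_def using one_closed by blast
qed

lemma conj_class_eq:
  assumes "H \<subseteq> carrier G" "K \<in> conj_class G H"
  shows "conj_class G K = conj_class G H"
proof -
  obtain g where g: "g \<in> carrier G" "K = (\<lambda>h. g \<otimes> h \<otimes> inv g) ` H"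
    using assms by (auto simp: conj_class_def)
  have KI: "(\<lambda>h. k \<otimes> h \<otimes> inv k) ` K = (\<lambda>h. (k \<otimes> g) \<otimes> h \<otimes> inv (k \<otimes> g)) ` H" if "k \<in> carrier G" for k
    unfolding g(2) using conj_image_conj_image[OF g(1) that assms(1)] .
  show ?thesis
  proof (intro equalityI subsetI)
    fix L assume "L \<in> conj_class G K"
    then show "L \<in> conj_class G H" using KI g(1) unfolding conj_class_def by blast
  next
    fix L assume "L \<in> conj_class G H"
    then obtain k where k: "k \<in> carrier G" "L = (\<lambda>h. k \<otimes> h \<otimes> inv k) ` H" by (auto simp: conj_class_def)
    then have "L = (\<lambda>h. (k \<otimes> inv g) \<otimes> h \<otimes> inv (k \<otimes> inv g)) ` K"
      using KI[of "k \<otimes> inv g"] g by (simp add: m_assoc)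
    then show "L \<in> conj_class G K" using k g unfolding conj_class_def by blast
  qed
qed

lemma rep_in: "C \<noteq> {} \<Longrightarrow> rep C \<in> C"
  unfolding rep_def by (simp add: some_in_eq)

lemma cyclic_subgroup_classes_eq:
  "cyclic_subgroup_classes G = (\<lambda>g. conj_class G (generate G {g})) ` carrier G"
proof (intro equalityI subsetI)
  fix C assume "C \<in> cyclic_subgroup_classes G"
  then obtain H where H: "subgroup H G" "cyclic_group (G\<lparr>carrier := H\<rparr>)" "C = conj_class G H"
    by (auto simp: cyclic_subgroup_classes_def)
  then obtain g where "g \<in> H" "H = generate G {g}" using cyclic_subgroup_iff by blast
  then show "C \<in> (\<lambda>g. conj_class G (generate G {g})) ` carrier G"
    using H(3) subgroup.mem_carrier[OF H(1)] by blast
next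
  fix C assume "C \<in> (\<lambda>g. conj_class G (generate G {g})) ` carrier G"
  then obtain g where g: "g \<in> carrier G" "C = conj_class G (generate G {g})" by blast
  then show "C \<in> cyclic_subgroup_classes G"
    using generate_subgroup1[OF g(1)] cyclic_subgroup_iff[OF generate_subgroup1[OF g(1)]]
      self_in_generate[of g]
    unfolding cyclic_subgroup_classes_def by blast
qed

lemma conj_class_generate_cases:
  assumes g: "g \<in> carrier G" and K: "K \<in> conj_class G (generate G {g})"
  obtains t where "t \<in> carrier G" "K = generate G {t \<otimes> g \<otimes> inv t}"
  using K conj_image_generate[OF _ g] unfolding conj_class_def by blast

lemma generate_subset_carrier: "g \<in> carrier G \<Longrightarrow> generate G {g} \<subseteq> carrier G"
  using subgroup.subset[OF generate_subgroup1] .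

lemma rep_conj_class_generate:
  assumes g: "g \<in> carrier G"
  obtains t where "t \<in> carrier G" "rep (conj_class G (generate G {g})) = generate G {t \<otimes> g \<otimes> inv t}"
proof -
  have "rep (conj_class G (generate G {g})) \<in> conj_class G (generate G {g})"
    using rep_in self_in_conj_class[OF generate_subset_carrier[OF g]] by blast
  then show ?thesis using conj_class_generate_cases[OF g] that by blast
qed

lemma conj_class_rep:
  assumes "C \<in> cyclic_subgroup_classes G"
  shows "conj_class G (rep C) = C" and "\<exists>d\<in>carrier G. rep C = generate G {d}"
proof -
  obtain g where g: "g \<in> carrier G" "C = conj_class G (generate G {g})"
    using assms cyclic_subgroup_classes_eq by blast
  have "rep C \<in> C" using rep_in self_in_conj_class[OF generate_subset_carrier[OF g(1)]] g by blast
  then show "conj_class G (rep C) = C"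
    using conj_class_eq[OF generate_subset_carrier[OF g(1)]] g by blast
  obtain t where "t \<in> carrier G" "rep C = generate G {t \<otimes> g \<otimes> inv t}"
    using rep_conj_class_generate[OF g(1)] g(2) by metis
  then show "\<exists>d\<in>carrier G. rep C = generate G {d}" using g by blast
qed

section \<open>Permutation characters and the system for the Artin coefficients\<close>

lemma perm_char_eq: "perm_char G H g = card {C \<in> lcosets H. g <# C = C}"
  unfolding perm_char_def LCOSETS_def by (rule arg_cong[where f = card]) auto

lemma lcoset_fixed_iff:
  assumes H: "subgroup H G" and x: "x \<in> carrier G" and g: "g \<in> carrier G"
  shows "g <# (x <# H) = x <# H \<longleftrightarrow> inv x \<otimes> g \<otimes> x \<in> H"
proof -
  have HG: "H \<subseteq> carrier G" using subgroup.subset[OF H] .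
  have 1: "g <# (x <# H) = (g \<otimes> x) <# H" using lcos_m_assoc[OF HG g x] .
  have "(g \<otimes> x) <# H = x <# H \<longleftrightarrow> g \<otimes> x \<in> x <# H"
    using lcos_self[of "g \<otimes> x" H] l_repr_independence[of "g \<otimes> x" x H] H x g by auto
  also have "\<dots> \<longleftrightarrow> inv x \<otimes> g \<otimes> x \<in> H"
  proof
    assume "g \<otimes> x \<in> x <# H"
    then obtain h where "h \<in> H" "g \<otimes> x = x \<otimes> h" by (auto simp: l_coset_def)
    then have "inv x \<otimes> g \<otimes> x = h" using x g HG by (metis inv_solve_left' m_assoc inv_closed subsetD m_closed)
    then show "inv x \<otimes> g \<otimes> x \<in> H" using \<open>h \<in> H\<close> by simp
  next
    assume *: "inv x \<otimes> g \<otimes> x \<in> H"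
    have "g \<otimes> x = x \<otimes> (inv x \<otimes> g \<otimes> x)" using x g by (simp flip: m_assoc)
    then show "g \<otimes> x \<in> x <# H" using * by (auto simp: l_coset_def)
  qed
  finally show ?thesis using 1 by simp
qed

lemma lcosets_cases:
  assumes "C \<in> lcosets H"
  obtains x where "x \<in> carrier G" "C = x <# H"
  using assms by (auto simp: LCOSETS_def)

lemma lcosets_subset: "subgroup H G \<Longrightarrow> C \<in> lcosets H \<Longrightarrow> C \<subseteq> carrier G"
  using l_coset_subset_G[of H] subgroup.subset[of H G] by (elim lcosets_cases) simp

lemma finite_lcosets: "finite (lcosets H)"
  using finite_carrier by (auto simp: LCOSETS_def)

text \<open>Powers of an element fix every coset that it fixes. Together with invariance under
  conjugation this leaves one equation per class of cyclic subgroups, which makes the system for the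
  coefficients square.\<close>

lemma perm_char_generate_cong:
  assumes H: "subgroup H G" and g: "g \<in> carrier G" "d \<in> carrier G" "generate G {g} = generate G {d}"
  shows "perm_char G H g = perm_char G H d"
proof -
  have "b <# C = C" if ab: "a \<in> carrier G" "b \<in> generate G {a}" "a <# C = C" and C: "C \<in> lcosets H" for a b C
  proof -
    obtain i :: nat where "b = a [^] i" using generate_cases_nat[OF ab(1,2)] .
    moreover have "a [^] i <# C = C" for i :: nat
    proof (induction i)
      case 0
      then show ?case using lcos_mult_one[OF lcosets_subset[OF H C]] by simp
    next
      case (Suc i)
      then show ?case
        using lcos_m_assoc[OF lcosets_subset[OF H C], of "a [^] i" a] ab by simp
    qed
    ultimately show ?thesis by simp
  qed
  moreover have "d \<in> generate G {g}" "g \<in> generate G {d}" using g(3) self_in_generate by auto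
  ultimately have "{C \<in> lcosets H. g <# C = C} = {C \<in> lcosets H. d <# C = C}" using g by blast
  then show ?thesis by (simp add: perm_char_eq)
qed

lemma perm_char_conj:
  assumes H: "subgroup H G" and g: "g \<in> carrier G" and t: "t \<in> carrier G"
  shows "perm_char G H (t \<otimes> g \<otimes> inv t) = perm_char G H g"
proof -
  have tC: "t <# C \<in> lcosets H" "inv t <# (t <# C) = C" "t <# (inv t <# C) = C" "inv t <# C \<in> lcosets H"
    if C: "C \<in> lcosets H" for C
  proof -
    obtain x where x: "x \<in> carrier G" "C = x <# H" using lcosets_cases[OF C] .
    have HG: "H \<subseteq> carrier G" using subgroup.subset[OF H] .
    show "t <# C \<in> lcosets H" "inv t <# C \<in> lcosets H"
      using x t lcos_m_assoc[OF HG] by (auto simp: LCOSETS_def)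
    show "inv t <# (t <# C) = C" "t <# (inv t <# C) = C"
      using lcos_m_assoc[OF lcosets_subset[OF H C]] lcos_mult_one[OF lcosets_subset[OF H C]] t by auto
  qed
  have fix_iff: "(t \<otimes> g \<otimes> inv t) <# (t <# C) = t <# C \<longleftrightarrow> g <# C = C" if C: "C \<in> lcosets H" for C
  proof -
    obtain x where x: "x \<in> carrier G" "C = x <# H" using lcosets_cases[OF C] .
    have "t <# C = (t \<otimes> x) <# H" using x t lcos_m_assoc[OF subgroup.subset[OF H]] by simp
    moreover have "inv (t \<otimes> x) \<otimes> (t \<otimes> g \<otimes> inv t) \<otimes> (t \<otimes> x) = inv x \<otimes> g \<otimes> x"
    proof -
      have "inv t \<otimes> (t \<otimes> (g \<otimes> (inv t \<otimes> (t \<otimes> x)))) = g \<otimes> x"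
        using x g t by (simp flip: m_assoc) 
      then show ?thesis using x g t by (simp add: inv_mult_group m_assoc)
    qed
    ultimately show ?thesis
      using lcoset_fixed_iff[OF H, of "t \<otimes> x" "t \<otimes> g \<otimes> inv t"] lcoset_fixed_iff[OF H, of x g] x g t by simp
  qed
  have "{C \<in> lcosets H. (t \<otimes> g \<otimes> inv t) <# C = C} = (\<lambda>C. t <# C) ` {C \<in> lcosets H. g <# C = C}"
  proof (intro equalityI subsetI)
    fix C assume "C \<in> {C \<in> lcosets H. (t \<otimes> g \<otimes> inv t) <# C = C}"
    then have C: "C \<in> lcosets H" "(t \<otimes> g \<otimes> inv t) <# C = C" by auto
    then have "g <# (inv t <# C) = inv t <# C" using fix_iff[OF tC(4)[OF C(1)]] tC(3)[OF C(1)] by simp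
    then show "C \<in> (\<lambda>C. t <# C) ` {C \<in> lcosets H. g <# C = C}"
      using tC(3,4)[OF C(1)] by (intro image_eqI[of _ _ "inv t <# C"]) auto
  next
    fix C assume "C \<in> (\<lambda>C. t <# C) ` {C \<in> lcosets H. g <# C = C}"
    then obtain B where "B \<in> lcosets H" "g <# B = B" "C = t <# B" by blast
    then show "C \<in> {C \<in> lcosets H. (t \<otimes> g \<otimes> inv t) <# C = C}"
      using tC(1)[of B] fix_iff[of B] by simp
  qed
  moreover have "inj_on (\<lambda>C. t <# C) {C \<in> lcosets H. g <# C = C}"
    using tC(2) by (intro inj_on_inverseI[where g = "\<lambda>C. inv t <# C"]) auto
  ultimately show ?thesis by (simp add: perm_char_eq card_image)
qed

lemma perm_char_pos_iff:
  assumes H: "subgroup H G" and g: "g \<in> carrier G"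
  shows "perm_char G H g \<noteq> 0 \<longleftrightarrow> (\<exists>x\<in>carrier G. inv x \<otimes> g \<otimes> x \<in> H)"
proof -
  have "perm_char G H g \<noteq> 0 \<longleftrightarrow> {C \<in> lcosets H. g <# C = C} \<noteq> {}"
    using finite_lcosets[of H] by (simp add: perm_char_eq)
  also have "\<dots> \<longleftrightarrow> (\<exists>x\<in>carrier G. g <# (x <# H) = x <# H)" by (auto simp: LCOSETS_def)
  finally show ?thesis using lcoset_fixed_iff[OF H _ g] by blast
qed

text \<open>The sample point at which the equation belonging to a class is tested.\<close>

definition class_gen :: "'a set set \<Rightarrow> 'a" where
  "class_gen C = (SOME d. d \<in> carrier G \<and> rep C = generate G {d})"

lemma class_gen:
  assumes "C \<in> cyclic_subgroup_classes G"
  shows "class_gen C \<in> carrier G" "rep C = generate G {class_gen C}"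
proof -
  have "\<exists>d. d \<in> carrier G \<and> rep C = generate G {d}" using conj_class_rep(2)[OF assms] by blast
  from someI_ex[OF this] show "class_gen C \<in> carrier G" "rep C = generate G {class_gen C}"
    unfolding class_gen_def by auto
qed

lemma rep_subgroup: "C \<in> cyclic_subgroup_classes G \<Longrightarrow> subgroup (rep C) G"
  using class_gen[of C] generate_subgroup1[of "class_gen C"] by simp

lemma perm_char_class_gen:
  assumes H: "subgroup H G" and g: "g \<in> carrier G"
  shows "perm_char G H g = perm_char G H (class_gen (conj_class G (generate G {g})))"
proof -
  let ?D = "conj_class G (generate G {g})"
  have D: "?D \<in> cyclic_subgroup_classes G" using cyclic_subgroup_classes_eq g by blast
  obtain t where t: "t \<in> carrier G" "rep ?D = generate G {t \<otimes> g \<otimes> inv t}"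
    using rep_conj_class_generate[OF g] .
  then have "generate G {t \<otimes> g \<otimes> inv t} = generate G {class_gen ?D}" using class_gen[OF D] by simp
  then have "perm_char G H (t \<otimes> g \<otimes> inv t) = perm_char G H (class_gen ?D)"
    using perm_char_generate_cong[OF H, of "t \<otimes> g \<otimes> inv t" "class_gen ?D"] class_gen(1)[OF D] t(1) g
    by blast
  then show ?thesis using perm_char_conj[OF H g t(1)] by simp
qed

lemma finite_subgroup_classes: "finite (subgroup_classes G)"
proof -
  have "subgroup_classes G \<subseteq> Pow (Pow (carrier G))"
    by (auto simp: subgroup_classes_def conj_class_def dest: subgroup.mem_carrier)
  then show ?thesis using finite_carrier finite_subset by blast
qed

lemma cyclic_subset_subgroup_classes: "cyclic_subgroup_classes G \<subseteq> subgroup_classes G"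
  by (auto simp: cyclic_subgroup_classes_def subgroup_classes_def)

text \<open>Artin induction for the trivial character, with uniqueness. The entry at (C, D) is
  nonzero iff the subgroup of D is conjugate into that of C; for distinct classes it is then
  strictly smaller, so the system is triangular with nonzero diagonal.\<close>

lemma artin_system_unique_solution:
  "\<exists>!\<alpha>. (\<forall>C. C \<notin> cyclic_subgroup_classes G \<longrightarrow> \<alpha> C = 0) \<and>
      (\<forall>g \<in> carrier G. (1::rat) =
          (\<Sum>C \<in> cyclic_subgroup_classes G. \<alpha> C * of_nat (perm_char G (rep C) g)))"
proof -
  let ?S = "cyclic_subgroup_classes G"
  let ?M = "\<lambda>C D. (of_nat (perm_char G (rep C) (class_gen D)) :: rat)"
  have fin: "finite ?S" using finite_subgroup_classes cyclic_subset_subgroup_classes finite_subset by blast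
  have diag: "?M C C \<noteq> 0" if C: "C \<in> ?S" for C
  proof -
    have "inv \<one> \<otimes> class_gen C \<otimes> \<one> \<in> rep C" using class_gen[OF C] self_in_generate by simp
    then show ?thesis using perm_char_pos_iff[OF rep_subgroup[OF C] class_gen(1)[OF C]] by (metis of_nat_eq_0_iff one_closed)
  qed
  have tri: "card (rep D) < card (rep C)" if CD: "C \<in> ?S" "D \<in> ?S" "C \<noteq> D" "?M C D \<noteq> 0" for C D
  proof -
    let ?d = "class_gen D"
    note d = class_gen[OF CD(2)]
    have R: "subgroup (rep C) G" using rep_subgroup[OF CD(1)] .
    obtain x where x: "x \<in> carrier G" "inv x \<otimes> ?d \<otimes> x \<in> rep C"
      using perm_char_pos_iff[OF R d(1)] CD(4) by auto
    \<comment> \<open>Written with \<open>inv (inv x)\<close> so that it is literally a conjugate by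
      \<open>inv x\<close>, the shape in \<open>ord_conj\<close> and
      \<open>conj_image_generate\<close>.\<close>
    let ?e = "inv x \<otimes> ?d \<otimes> inv (inv x)"
    have e: "?e \<in> carrier G" "?e \<in> rep C" using x d by auto
    have sub: "generate G {?e} \<subseteq> rep C" using generate_subgroup_incl[OF _ R, of "{?e}"] e by simp
    have cD: "card (rep D) = card (generate G {?e})"
      using d generate_pow_card[of ?d] generate_pow_card[OF e(1)] ord_conj[of "inv x" ?d] x by simp
    have "generate G {?e} \<noteq> rep C"
    proof
      assume "generate G {?e} = rep C"
      then have "rep C = (\<lambda>h. inv x \<otimes> h \<otimes> inv (inv x)) ` rep D"
        using conj_image_generate[of "inv x" ?d] x d by simp
      then have "rep C \<in> conj_class G (rep D)" unfolding conj_class_def using x(1) inv_closed by blast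
      then have "conj_class G (rep C) = conj_class G (rep D)"
        using conj_class_eq subgroup.subset[OF rep_subgroup[OF CD(2)]] by blast
      then show False using conj_class_rep(1) CD by simp
    qed
    then show ?thesis using sub cD subgroup_finite[OF R] psubset_card_mono by (metis psubsetI)
  qed
  have eq: "(\<forall>g \<in> carrier G. (1::rat) = (\<Sum>C \<in> ?S. \<alpha> C * of_nat (perm_char G (rep C) g)))
      \<longleftrightarrow> (\<forall>D\<in>?S. 1 = (\<Sum>C\<in>?S. \<alpha> C * ?M C D))" for \<alpha>
  proof
    assume *: "\<forall>D\<in>?S. 1 = (\<Sum>C\<in>?S. \<alpha> C * ?M C D)"
    show "\<forall>g \<in> carrier G. (1::rat) = (\<Sum>C \<in> ?S. \<alpha> C * of_nat (perm_char G (rep C) g))"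
    proof
      fix g assume g: "g \<in> carrier G"
      let ?D = "conj_class G (generate G {g})"
      have "(\<Sum>C \<in> ?S. \<alpha> C * of_nat (perm_char G (rep C) g)) = (\<Sum>C\<in>?S. \<alpha> C * ?M C ?D)"
        using perm_char_class_gen[OF rep_subgroup g] by (intro sum.cong) auto
      then show "(1::rat) = (\<Sum>C \<in> ?S. \<alpha> C * of_nat (perm_char G (rep C) g))"
        using * cyclic_subgroup_classes_eq g by auto
    qed
  qed (use class_gen(1) in blast)
  show ?thesis unfolding eq
    using triangular_system_unique_solution[where f = "\<lambda>_. 1" and sz = "\<lambda>C. card (rep C)", of ?S ?M] fin diag tri
    by blast
qed

lemma artin_coeff:
  "C \<notin> cyclic_subgroup_classes G \<Longrightarrow> artin_coeff G C = 0"
  "g \<in> carrier G \<Longrightarrow>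
    (\<Sum>C \<in> cyclic_subgroup_classes G. artin_coeff G C * of_nat (perm_char G (rep C) g)) = 1"
  using theI'[OF artin_system_unique_solution, folded artin_coeff_def] by auto

section \<open>Evaluating the regulator constant with the weight\<close>

lemma wt_conj: "t \<in> carrier G \<Longrightarrow> h \<in> carrier G \<Longrightarrow> wt (t \<otimes> h \<otimes> inv t) = wt h"
  by (simp add: wt_def ord_conj)

text \<open>Frobenius reciprocity by double counting pairs of an element and a coset fixed by it.
  The coset xH is fixed exactly by x H x^-1; as the weight is a class function, each coset
  contributes |H| v_p|H|, and the number of cosets times |H| is |G|.\<close>

lemma sum_wt_perm_char:
  assumes h: "h \<in> carrier G"
  defines "H \<equiv> generate G {h}"
  shows "(\<Sum>g\<in>carrier G. wt g * of_nat (perm_char G H g))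
    = of_nat (card (carrier G)) * of_nat (multiplicity p (card H))"
proof -
  have H: "subgroup H G" unfolding H_def using generate_subgroup1[OF h] .
  have "wt g * of_nat (perm_char G H g) = (\<Sum>C\<in>lcosets H. if g <# C = C then wt g else 0)" for g
  proof -
    have "lcosets H \<inter> {C. g <# C = C} = {C \<in> lcosets H. g <# C = C}" by auto
    then show ?thesis using finite_lcosets[of H] by (simp add: perm_char_eq sum.If_cases)
  qed
  then have "(\<Sum>g\<in>carrier G. wt g * of_nat (perm_char G H g))
      = (\<Sum>g\<in>carrier G. \<Sum>C\<in>lcosets H. if g <# C = C then wt g else 0)" by simp
  also have "\<dots> = (\<Sum>C\<in>lcosets H. \<Sum>g\<in>carrier G. if g <# C = C then wt g else 0)"
    by (rule sum.swap)
  also have "\<dots> = (\<Sum>C\<in>lcosets H. \<Sum>k\<in>H. wt k)"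
  proof (rule sum.cong)
    fix C assume "C \<in> lcosets H"
    then obtain x where x: "x \<in> carrier G" "C = x <# H" using lcosets_cases by blast
    have "carrier G \<inter> {g. g <# C = C} = (\<lambda>k. x \<otimes> k \<otimes> inv x) ` H"
    proof (intro equalityI subsetI)
      fix g assume "g \<in> carrier G \<inter> {g. g <# C = C}"
      then have g: "g \<in> carrier G" "inv x \<otimes> g \<otimes> x \<in> H" using lcoset_fixed_iff[OF H x(1)] x by auto
      have "g = x \<otimes> (inv x \<otimes> g \<otimes> x) \<otimes> inv x" using conj_inv_conj[of "inv x" g] x g by simp
      then show "g \<in> (\<lambda>k. x \<otimes> k \<otimes> inv x) ` H" using g by blast
    next
      fix g assume "g \<in> (\<lambda>k. x \<otimes> k \<otimes> inv x) ` H"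
      then obtain k where k: "k \<in> H" "g = x \<otimes> k \<otimes> inv x" by blast
      then have "k \<in> carrier G" using subgroup.mem_carrier[OF H] by blast
      then show "g \<in> carrier G \<inter> {g. g <# C = C}"
        using k x lcoset_fixed_iff[OF H x(1)] conj_inv_conj[of x k] by auto
    qed
    moreover have "inj_on (\<lambda>k. x \<otimes> k \<otimes> inv x) H"
      using conj_inj_on[OF x(1)] subgroup.subset[OF H] inj_on_subset by blast
    ultimately have "(\<Sum>g\<in>carrier G. if g <# C = C then wt g else 0) = (\<Sum>k\<in>H. wt (x \<otimes> k \<otimes> inv x))"
      using finite_carrier by (simp add: sum.If_cases sum.reindex)
    also have "\<dots> = (\<Sum>k\<in>H. wt k)"
      using wt_conj[OF x(1)] subgroup.mem_carrier[OF H] by (intro sum.cong) auto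
    finally show "(\<Sum>g\<in>carrier G. if g <# C = C then wt g else 0) = (\<Sum>k\<in>H. wt k)" .
  qed simp
  also have "\<dots> = of_nat (card (lcosets H) * card H) * of_nat (multiplicity p (card H))"
    using sum_wt_cyclic[OF h] by (simp add: H_def)
  also have "card (lcosets H) * card H = card (carrier G)"
    using l_lagrange[OF finite_carrier H] by (simp add: order_def)
  finally show ?thesis .
qed

lemma vp_regconst_triv_artin_relation:
  "vp_regconst_triv G p (artin_relation G) = - defect (carrier G) / of_nat (card (carrier G))"
proof -
  let ?S = "cyclic_subgroup_classes G" and ?n = "of_nat (card (carrier G)) :: rat"
  let ?v = "\<lambda>C. of_nat (multiplicity p (card (rep C))) :: rat"
  let ?K = "conj_class G (carrier G)"
  have fin: "finite (subgroup_classes G)" by (rule finite_subgroup_classes)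
  have finS: "finite ?S" using fin cyclic_subset_subgroup_classes finite_subset by blast
  have n0: "?n \<noteq> 0" using card_subgroup_pos[OF subgroup_self] by simp
  have "(\<Sum>g\<in>carrier G. wt g)
      = (\<Sum>g\<in>carrier G. wt g * (\<Sum>C\<in>?S. artin_coeff G C * of_nat (perm_char G (rep C) g)))"
    using artin_coeff(2) by (intro sum.cong) auto
  also have "\<dots> = (\<Sum>g\<in>carrier G. \<Sum>C\<in>?S. artin_coeff G C * (wt g * of_nat (perm_char G (rep C) g)))"
    by (simp add: sum_distrib_left mult.left_commute)
  also have "\<dots> = (\<Sum>C\<in>?S. \<Sum>g\<in>carrier G. artin_coeff G C * (wt g * of_nat (perm_char G (rep C) g)))"
    by (rule sum.swap)
  also have "\<dots> = (\<Sum>C\<in>?S. artin_coeff G C * (?n * ?v C))"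
  proof (rule sum.cong)
    fix C assume C: "C \<in> ?S"
    show "(\<Sum>g\<in>carrier G. artin_coeff G C * (wt g * of_nat (perm_char G (rep C) g)))
        = artin_coeff G C * (?n * ?v C)"
      using sum_wt_perm_char[OF class_gen(1)[OF C]] class_gen(2)[OF C] by (simp flip: sum_distrib_left)
  qed simp
  also have "\<dots> = ?n * (\<Sum>C\<in>?S. artin_coeff G C * ?v C)"
    by (simp add: sum_distrib_left mult.left_commute)
  finally have 1: "?n * (\<Sum>C\<in>?S. artin_coeff G C * ?v C)
      = ?n * of_nat (multiplicity p (card (carrier G))) - defect (carrier G)"
    using sum_wt[OF subgroup_self] by simp
  \<comment> \<open>The class of the whole group is a singleton, so its representative is G itself.
    The two summands of the relation are summed separately, which also covers cyclic G, where this
    class may carry a coefficient as well.\<close>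
  have K: "?K = {carrier G}" "?K \<in> subgroup_classes G"
    using conj_image_carrier one_closed subgroup_self
    by (auto simp: conj_class_def subgroup_classes_def)
  have repK: "rep ?K = carrier G" using rep_in[of ?K] K by auto
  have "(\<Sum>C\<in>subgroup_classes G. artin_coeff G C * ?v C) = (\<Sum>C\<in>?S. artin_coeff G C * ?v C)"
    using fin cyclic_subset_subgroup_classes artin_coeff(1) by (intro sum.mono_neutral_right) auto
  moreover have "(\<Sum>C\<in>subgroup_classes G. (if C = ?K then 1 else 0) * ?v C) = ?v ?K"
    using fin K by (simp add: if_distrib[of "\<lambda>t. t * _"] cong: if_cong)
  ultimately have "vp_regconst_triv G p (artin_relation G)
      = (\<Sum>C\<in>?S. artin_coeff G C * ?v C) - of_nat (multiplicity p (card (carrier G)))"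
    unfolding vp_regconst_triv_def artin_relation_def
    by (simp add: left_diff_distrib sum_subtractf repK)
  moreover have "(\<Sum>C\<in>?S. artin_coeff G C * ?v C)
      = of_nat (multiplicity p (card (carrier G))) - defect (carrier G) / ?n"
    using 1 n0 by (simp add: field_simps)
  ultimately show ?thesis by simp
qed

end

theorem theorem1p2:
  fixes G :: "('a, 'b) monoid_scheme" and p :: nat
  assumes "group G" and "finite (carrier G)" and "prime p"
  shows "(vp_regconst_triv G p (artin_relation G) \<noteq> 0 \<longleftrightarrow>
            (\<exists>H. p_hypo_elementary G p H \<and> \<not> cyclic_group (G\<lparr>carrier := H\<rparr>)))
       \<and> ((\<exists>H. p_hypo_elementary G p H \<and> \<not> cyclic_group (G\<lparr>carrier := H\<rparr>)) \<longrightarrow>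
            vp_regconst_triv G p (artin_relation G) \<le> - (of_nat p / of_nat (card (carrier G))))"
proof -
  interpret finite_group_prime G p
    using assms by (simp add: finite_group_prime_def finite_group_prime_axioms_def)
  let ?D = "defect (carrier G)" and ?n = "of_nat (card (carrier G)) :: rat"
  have n: "?n > 0" using card_subgroup_pos[OF subgroup_self] by simp
  have D: "?D \<noteq> 0 \<longleftrightarrow> (\<exists>H. p_hypo_elementary G p H \<and> \<not> cyclic_group (G\<lparr>carrier := H\<rparr>))"
    using defect_eq_0_if_hypo_elementary_cyclic hypo_elementary_cyclic_if_defect_eq_0 by blast
  have v: "vp_regconst_triv G p (artin_relation G) = - (?D / ?n)"
    using vp_regconst_triv_artin_relation by simp
  have "- (?D / ?n) \<le> - (of_nat p / ?n)" if "?D \<noteq> 0"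
    using defect_ge_p[OF subgroup_self that] n by (simp add: divide_right_mono)
  then show ?thesis unfolding v using D n by simp
qed

end
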